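(* Suppose that $T : A \to B$ is a completely isometric surjection between approximately unital operator algebras. Then $T$ is real (completely) positive if and only if $T$ is an algebra homomorphism. (That is, both the version with `real positive' and the version with `real completely positive' hold.)
   Context: An operator algebra is a norm-closed, not necessarily selfadjoint, subalgebra of $B(H)$ for a Hilbert space $H$, with its inherited operator space structure. It is approximately unital if it has a contractive approximate identity. Completely isometric surjections are linear. Write $\mathfrak{r}_A = \{x \in A : x + x^* \geq 0\}$; a linear map $T : A \to B$ is real positive if $T(\mathfrak{r}_A) \subset \mathfrak{r}_B$, and real completely positive if its amplification $T_n : M_n(A) \to M_n(B)$ is real positive for all $n \in \mathbb{N}$. *)

theory Defs
  imports "HOL-Analysis.Analysis"
begin

section \<open>Complex Hilbert spaces\<close>

text \<open>
  The distribution only has real inner product spaces. A complex Hilbert space is a complete one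
  whose real inner product is the real part of a sesquilinear form; in particular its norm
  satisfies \<open>cinner x x = (norm x)\<^sup>2\<close>. The form is linear in its first argument.
\<close>

class chilbert_space = real_inner + complete_space +
  fixes scaleC :: "complex \<Rightarrow> 'a \<Rightarrow> 'a"  (infixr \<open>*\<^sub>C\<close> 75)
    and cinner :: "'a \<Rightarrow> 'a \<Rightarrow> complex"
  assumes scaleC_add_right: "c *\<^sub>C (x + y) = c *\<^sub>C x + c *\<^sub>C y"
    and scaleC_add_left: "(c + d) *\<^sub>C x = c *\<^sub>C x + d *\<^sub>C x"
    and scaleC_scaleC: "c *\<^sub>C d *\<^sub>C x = (c * d) *\<^sub>C x"
    and scaleC_of_real: "complex_of_real r *\<^sub>C x = r *\<^sub>R x"
    and cinner_commute: "cinner x y = cnj (cinner y x)"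
    and cinner_add_left: "cinner (x + y) z = cinner x z + cinner y z"
    and cinner_scaleC_left: "cinner (c *\<^sub>C x) y = c * cinner x y"
    and Re_cinner: "Re (cinner x y) = inner x y"

lemma cinner_self: "cinner x x = complex_of_real ((norm x)\<^sup>2)"
  for x :: "'a::chilbert_space"
proof (rule complex_eqI)
  have "Im (cinner x x) = - Im (cinner x x)"
    using arg_cong [OF cinner_commute [of x x], of Im] by simp
  then show "Im (cinner x x) = Im (complex_of_real ((norm x)\<^sup>2))"
    by simp
qed (simp add: Re_cinner power2_norm_eq_inner)

lemma norm_scaleC: "norm (c *\<^sub>C x) = cmod c * norm x"
  for x :: "'a::chilbert_space"
proof -
  have "cinner (c *\<^sub>C x) (c *\<^sub>C x) = c * cnj c * cinner x x"
    by (metis (no_types) cinner_commute cinner_scaleC_left complex_cnj_mult mult.assoc)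
  then have "complex_of_real ((norm (c *\<^sub>C x))\<^sup>2) = complex_of_real ((cmod c * norm x)\<^sup>2)"
    by (simp only: cinner_self complex_norm_square [symmetric] of_real_mult [symmetric]
        power_mult_distrib)
  then have "(norm (c *\<^sub>C x))\<^sup>2 = (cmod c * norm x)\<^sup>2"
    by (simp only: of_real_eq_iff)
  then show ?thesis
    by (rule power2_eq_imp_eq) simp_all
qed


section \<open>Bounded operators\<close>

text \<open>
  The library type \<open>'h \<Rightarrow>\<^sub>L 'h\<close> consists of the bounded real-linear maps; its norm is the operator
  norm. \<open>B(H)\<close> is the set of the complex-linear ones.
\<close>

type_synonym 'h op = "'h \<Rightarrow>\<^sub>L 'h"

definition BH :: "'h::chilbert_space op set" where
  "BH = {f. \<forall>c x. blinfun_apply f (c *\<^sub>C x) = c *\<^sub>C blinfun_apply f x}"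

lift_definition op_scaleC :: "complex \<Rightarrow> 'h::chilbert_space op \<Rightarrow> 'h op"
  is "\<lambda>c f x. c *\<^sub>C f x"
proof -
  fix c and f :: "'h \<Rightarrow> 'h"
  assume f: "bounded_linear f"
  have "bounded_linear (\<lambda>x::'h. c *\<^sub>C x)"
  proof (rule bounded_linear_intro [where K = "cmod c"])
    show "c *\<^sub>C (r *\<^sub>R x) = r *\<^sub>R (c *\<^sub>C x)" for r and x :: 'h
      by (simp add: scaleC_of_real [symmetric] scaleC_scaleC mult.commute)
  qed (simp_all add: scaleC_add_right norm_scaleC mult.commute)
  from bounded_linear_compose [OF this f] show "bounded_linear (\<lambda>x. c *\<^sub>C f x)" .
qed

definition op_adj :: "'h::chilbert_space op \<Rightarrow> 'h op" where
  "op_adj f = (THE g. \<forall>x y. cinner (blinfun_apply f x) y = cinner x (blinfun_apply g y))"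

definition op_pos :: "'h::chilbert_space op \<Rightarrow> bool" where
  "op_pos f \<longleftrightarrow> (\<forall>x. cinner (blinfun_apply f x) x \<in> \<real>\<^sub>\<ge>\<^sub>0)"


section \<open>Matrices of operators\<close>

text \<open>
  An \<open>n \<times> n\<close> matrix of operators is a function \<open>nat \<Rightarrow> nat \<Rightarrow> 'h op\<close> of which only the entries
  with both indices below \<open>n\<close> matter. It acts on the Hilbert space \<open>H\<^sup>n\<close>, whose elements are given
  as functions \<open>nat \<Rightarrow> 'h\<close> restricted to \<open>{..<n}\<close>, and \<open>mat_norm n\<close>, \<open>mat_adj\<close> and \<open>mat_pos n\<close>
  are the norm, the adjoint and positivity in \<open>B(H\<^sup>n) = M\<^sub>n(B(H))\<close>.
\<close>

type_synonym 'h op_mat = "nat \<Rightarrow> nat \<Rightarrow> 'h op"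

definition mat_over :: "nat \<Rightarrow> 'h::chilbert_space op set \<Rightarrow> 'h op_mat set" where
  "mat_over n A = {a. \<forall>i<n. \<forall>j<n. a i j \<in> A}"

definition mat_apply :: "nat \<Rightarrow> 'h::chilbert_space op_mat \<Rightarrow> (nat \<Rightarrow> 'h) \<Rightarrow> (nat \<Rightarrow> 'h)" where
  "mat_apply n a x = (\<lambda>i. \<Sum>j<n. blinfun_apply (a i j) (x j))"

definition vec_norm :: "nat \<Rightarrow> (nat \<Rightarrow> 'h::chilbert_space) \<Rightarrow> real" where
  "vec_norm n x = L2_set (\<lambda>i. norm (x i)) {..<n}"

definition vec_cinner ::
    "nat \<Rightarrow> (nat \<Rightarrow> 'h::chilbert_space) \<Rightarrow> (nat \<Rightarrow> 'h) \<Rightarrow> complex" where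
  "vec_cinner n x y = (\<Sum>i<n. cinner (x i) (y i))"

definition mat_norm :: "nat \<Rightarrow> 'h::chilbert_space op_mat \<Rightarrow> real" where
  "mat_norm n a = (SUP x\<in>{x. vec_norm n x \<le> 1}. vec_norm n (mat_apply n a x))"

definition mat_add :: "'h::chilbert_space op_mat \<Rightarrow> 'h op_mat \<Rightarrow> 'h op_mat" where
  "mat_add a b = (\<lambda>i j. a i j + b i j)"

definition mat_adj :: "'h::chilbert_space op_mat \<Rightarrow> 'h op_mat" where
  "mat_adj a = (\<lambda>i j. op_adj (a j i))"

definition mat_pos :: "nat \<Rightarrow> 'h::chilbert_space op_mat \<Rightarrow> bool" where
  "mat_pos n a \<longleftrightarrow> (\<forall>x. vec_cinner n (mat_apply n a x) x \<in> \<real>\<^sub>\<ge>\<^sub>0)"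

definition amplification ::
    "('h::chilbert_space op \<Rightarrow> 'k::chilbert_space op) \<Rightarrow> 'h op_mat \<Rightarrow> 'k op_mat" where
  "amplification T a = (\<lambda>i j. T (a i j))"


section \<open>Operator algebras\<close>

definition operator_algebra :: "'h::chilbert_space op set \<Rightarrow> bool" where
  "operator_algebra A \<longleftrightarrow>
     A \<subseteq> BH \<and> closed A \<and> 0 \<in> A \<and>
     (\<forall>a\<in>A. \<forall>b\<in>A. a + b \<in> A) \<and>
     (\<forall>c. \<forall>a\<in>A. op_scaleC c a \<in> A) \<and>
     (\<forall>a\<in>A. \<forall>b\<in>A. a o\<^sub>L b \<in> A)"

text \<open>
  Nets are rendered as proper filters: a net gives rise to the filter generated by its tails, and
  every proper filter arises from a net in this way.
\<close>

definition approximately_unital :: "'h::chilbert_space op set \<Rightarrow> bool" where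
  "approximately_unital A \<longleftrightarrow>
     (\<exists>F. F \<noteq> bot \<and> (\<forall>\<^sub>F e in F. e \<in> A \<and> norm e \<le> 1) \<and>
          (\<forall>a\<in>A. ((\<lambda>e. e o\<^sub>L a) \<longlongrightarrow> a) F \<and> ((\<lambda>e. a o\<^sub>L e) \<longlongrightarrow> a) F))"

text \<open>
  A map \<open>A \<rightarrow> B\<close> is a function on all operators, of which only the values on \<open>A\<close> matter.
\<close>

definition linear_map ::
    "'h::chilbert_space op set \<Rightarrow> 'k::chilbert_space op set \<Rightarrow> ('h op \<Rightarrow> 'k op) \<Rightarrow> bool" where
  "linear_map A B T \<longleftrightarrow>
     T ` A \<subseteq> B \<and>
     (\<forall>a\<in>A. \<forall>b\<in>A. T (a + b) = T a + T b) \<and>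
     (\<forall>c. \<forall>a\<in>A. T (op_scaleC c a) = op_scaleC c (T a))"

definition completely_isometric_surjection ::
    "'h::chilbert_space op set \<Rightarrow> 'k::chilbert_space op set \<Rightarrow> ('h op \<Rightarrow> 'k op) \<Rightarrow> bool" where
  "completely_isometric_surjection A B T \<longleftrightarrow>
     linear_map A B T \<and> T ` A = B \<and>
     (\<forall>n\<ge>1. \<forall>a\<in>mat_over n A. mat_norm n (amplification T a) = mat_norm n a)"

definition algebra_homomorphism ::
    "'h::chilbert_space op set \<Rightarrow> 'k::chilbert_space op set \<Rightarrow> ('h op \<Rightarrow> 'k op) \<Rightarrow> bool" where
  "algebra_homomorphism A B T \<longleftrightarrow>
     linear_map A B T \<and> (\<forall>a\<in>A. \<forall>b\<in>A. T (a o\<^sub>L b) = T a o\<^sub>L T b)"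

definition real_pos_elems :: "'h::chilbert_space op set \<Rightarrow> 'h op set" where
  "real_pos_elems A = {a \<in> A. op_pos (a + op_adj a)}"

definition mat_real_pos_elems :: "nat \<Rightarrow> 'h::chilbert_space op set \<Rightarrow> 'h op_mat set" where
  "mat_real_pos_elems n A = {a \<in> mat_over n A. mat_pos n (mat_add a (mat_adj a))}"

definition real_positive ::
    "'h::chilbert_space op set \<Rightarrow> 'k::chilbert_space op set \<Rightarrow> ('h op \<Rightarrow> 'k op) \<Rightarrow> bool" where
  "real_positive A B T \<longleftrightarrow> linear_map A B T \<and> T ` real_pos_elems A \<subseteq> real_pos_elems B"

definition real_completely_positive ::
    "'h::chilbert_space op set \<Rightarrow> 'k::chilbert_space op set \<Rightarrow> ('h op \<Rightarrow> 'k op) \<Rightarrow> bool" where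
  "real_completely_positive A B T \<longleftrightarrow>
     linear_map A B T \<and>
     (\<forall>n\<ge>1. amplification T ` mat_real_pos_elems n A \<subseteq> mat_real_pos_elems n B)"

end

theory Submission
  imports Defs "HOL-Complex_Analysis.Cauchy_Integral_Formula"
begin

text \<open>
  Call an operator \<open>x\<close> accretive if \<open>Re \<langle>x v, v\<rangle> \<ge> 0\<close> for all \<open>v\<close>, that is, if \<open>x + x\<^sup>* \<ge> 0\<close>. Both
  implications rest on reading algebra off from norms.

  A homomorphism preserves accretivity because accretivity of \<open>x\<close> is the norm condition
  \<open>\<parallel>1 - t x\<parallel> \<le> 1 + O(t\<^sup>2)\<close> for \<open>t \<down> 0\<close>. The identity need not lie in the algebra, so \<open>1 - t x\<close> is
  replaced by \<open>e (1 - t x) e\<close> with \<open>e\<close> from an approximate unit. This is built from \<open>e\<close> and \<open>x\<close> by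
  products and sums, so a homomorphism carries it to the corresponding element of \<open>B\<close>, and letting
  \<open>e\<close> run through the approximate unit recovers accretivity of the image. The same works for
  matrices (\<open>real_completely_positive_of_homomorphism\<close>).

  For the converse let \<open>T\<close> be real positive. There are three steps.

  First, \<open>A\<close> contains many accretive elements. If \<open>y\<^sub>1\<close> and \<open>y\<^sub>2\<close> are contractions from an
  approximate unit and \<open>y\<^sub>2\<close> acts almost as a unit on \<open>y\<^sub>1\<close>, then their skew parts
  \<open>y\<^sub>i - y\<^sub>i\<^sup>*\<close> are almost orthogonal, so averaging shrinks the skew part and produces almost
  selfadjoint units \<open>y\<close> (\<open>nearly_selfadjoint_unit\<close>). Adding multiples of such \<open>y\<^sup>2 \<approx> y\<^sup>* y\<close> repairs
  a small failure of accretivity (\<open>accretive_approximation\<close>), so \<open>T\<close> also respects accretivity up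
  to a small error.

  Secondly, \<open>T\<close> maps suitable units of \<open>A\<close> to units of \<open>B\<close> (\<open>unit_with_unit_image\<close>). Let \<open>f\<close> be a
  contractive almost unit of \<open>B\<close> and \<open>a = T\<^sup>-\<^sup>1 f\<close>. As \<open>\<parallel>a\<parallel> \<le> 1\<close>, the element \<open>e - a\<close> is almost
  accretive for a good unit \<open>e = y\<^sup>2\<close> of \<open>A\<close>. Hence \<open>Re T e \<ge> Re f\<close> up to a small error, and a
  contraction whose real part is almost \<open>1\<close> at a vector almost fixes this vector.

  Thirdly, the norm of columns with two entries and the unit determine the product. On columns
  \<open>(x, y)\<close> the field \<open>(1 - x\<^sup>2, - y x)\<close> generates Moebius transformations of the unit ball, so moving
  a contraction along it for a time \<open>t\<close> keeps the norm below \<open>1 + O(t\<^sup>2)\<close> (\<open>moebius_column\<close>). Move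
  forwards with the product of \<open>A\<close>, apply \<open>T\<close>, and move backwards with the product of \<open>B\<close>. What
  remains is a displacement by \<open>t (\<delta>(x, x), \<delta>(y, x))\<close>, where \<open>\<delta>(b, d) = b d - T (T\<^sup>-\<^sup>1 b T\<^sup>-\<^sup>1 d)\<close>
  measures the failure of multiplicativity (\<open>column_stays_in_ball\<close>). A quadratic field which keeps
  the ball invariant up to \<open>O(t\<^sup>2)\<close> for all small complex \<open>t\<close> vanishes, by the iteration argument
  behind Cartan's uniqueness theorem (\<open>product_eq_0\<close>). The second entry of the column is what gives
  \<open>\<delta>(y, x) = 0\<close> for all pairs; single operators would only give \<open>\<delta>(x, x) = 0\<close>, a Jordan homomorphism.
\<close>

section \<open>Adjoints and accretive operators\<close>

text \<open>
  The representing vector is the minimiser of \<open>\<parallel>x\<parallel>\<^sup>2 - 2 \<phi>(x)\<close>. A minimising sequence is Cauchy by the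
  parallelogram identity.
\<close>

lemma riesz_representation:
  fixes \<phi> :: "'a::{real_inner, complete_space} \<Rightarrow> real"
  assumes "bounded_linear \<phi>"
  shows "\<exists>z. \<forall>x. \<phi> x = inner x z"
proof -
  interpret bounded_linear \<phi> by fact
  define J where "J x = (norm x)\<^sup>2 - 2 * \<phi> x" for x
  obtain K where K: "\<And>x. \<bar>\<phi> x\<bar> \<le> norm x * K"
    using bounded by auto
  have J_ge: "- K\<^sup>2 \<le> J x" for x
  proof -
    have "0 \<le> (norm x - K)\<^sup>2" by simp
    moreover have "\<phi> x \<le> norm x * K" using K[of x] by simp
    ultimately show ?thesis
      unfolding J_def power2_diff by linarith
  qed
  have bdd: "bdd_below (range J)"
    by (rule bdd_belowI2[of UNIV "- K\<^sup>2"]) (rule J_ge)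
  define m where "m = Inf (range J)"
  have m_le: "m \<le> J x" for x
    unfolding m_def by (rule cInf_lower[OF _ bdd]) simp
  have "\<exists>x. J x < m + 1 / (real n + 1)" for n
    using cInf_lessD[of "range J" "m + 1 / (real n + 1)"] by (auto simp: m_def)
  then obtain X where X: "\<And>n. J (X n) < m + 1 / (real n + 1)"
    by metis
  have parallelogram: "(norm (x - y))\<^sup>2 = 2 * (J x + J y - 2 * J ((1/2) *\<^sub>R (x + y)))" for x y
    unfolding J_def power2_norm_eq_inner
    by (simp add: inner_diff_left inner_diff_right inner_add_left inner_add_right scaleR add
        inner_commute add_divide_distrib)
  have close: "(norm (X i - X j))\<^sup>2 \<le> 2 * (1 / (real i + 1) + 1 / (real j + 1))" for i j
  proof -
    have "J (X i) + J (X j) - 2 * J ((1/2) *\<^sub>R (X i + X j)) \<le> 1 / (real i + 1) + 1 / (real j + 1)"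
      using add_strict_mono[OF X[of i] X[of j]] m_le[of "(1/2) *\<^sub>R (X i + X j)"] by simp
    then show ?thesis unfolding parallelogram[of "X i" "X j"] by simp
  qed
  have "Cauchy X"
    unfolding Cauchy_altdef
  proof (intro allI impI)
    fix e :: real assume e: "0 < e"
    obtain M where M: "4 / e\<^sup>2 < real M"
      using reals_Archimedean2 by blast
    show "\<exists>M. \<forall>m\<ge>M. \<forall>n>m. dist (X m) (X n) < e"
    proof (intro exI allI impI)
      fix i j assume ij: "M \<le> i" "i < j"
      have *: "1 / (real k + 1) < e\<^sup>2 / 4" if "M \<le> k" for k
      proof -
        have "4 < e\<^sup>2 * (real k + 1)"
        proof -
          have "4 < e\<^sup>2 * real M" using M e by (simp add: field_simps)
          also have "\<dots> \<le> e\<^sup>2 * (real k + 1)" using that by (intro mult_left_mono) auto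
          finally show ?thesis .
        qed
        then show ?thesis by (simp add: field_simps)
      qed
      have "(norm (X i - X j))\<^sup>2 < e\<^sup>2"
        using close[of i j] *[of i] *[of j] ij by simp
      then show "dist (X i) (X j) < e"
        using e by (simp add: dist_norm power_less_imp_less_base)
    qed
  qed
  then obtain z where z: "X \<longlonglongrightarrow> z"
    using Cauchy_convergent_iff convergent_def by blast
  have "(\<lambda>n. J (X n)) \<longlonglongrightarrow> J z"
    unfolding J_def by (intro tendsto_intros tendsto z)
  moreover have "(\<lambda>n. m + 1 / (real n + 1)) \<longlonglongrightarrow> m + 0"
    using LIMSEQ_inverse_real_of_nat
    by (intro tendsto_intros) (simp add: inverse_eq_divide add.commute)
  ultimately have "J z \<le> m + 0"
    by (rule LIMSEQ_le) (use X less_imp_le in auto)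
  then have min: "J z \<le> J y" for y
    using m_le[of y] by simp
  have "\<phi> h = inner h z" for h
  proof (rule ccontr)
    assume "\<phi> h \<noteq> inner h z"
    define c where "c = inner h z - \<phi> h"
    define d where "d = (norm h)\<^sup>2 + 1"
    have d: "d > 0" unfolding d_def by (simp add: add_nonneg_pos)
    have c: "c \<noteq> 0" using \<open>\<phi> h \<noteq> inner h z\<close> by (simp add: c_def)
    define t where "t = - c / d"
    have "J (z + t *\<^sub>R h) - J z = 2 * t * c + t\<^sup>2 * (norm h)\<^sup>2"
      unfolding J_def c_def power2_norm_eq_inner
      by (simp add: inner_add_left inner_add_right add scaleR inner_commute power2_eq_square
          algebra_simps)
    also have "\<dots> = 2 * t * c + t\<^sup>2 * (d - 1)" by (simp add: d_def)
    also have "\<dots> = - (c\<^sup>2 / d) - t\<^sup>2"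
      using d by (simp add: t_def field_simps power2_eq_square)
    also have "\<dots> < 0"
    proof -
      have "0 < c\<^sup>2 / d" using c d by simp
      then show ?thesis using zero_le_power2[of t] by linarith
    qed
    finally show False using min[of "z + t *\<^sub>R h"] by simp
  qed
  then show ?thesis by blast
qed

text \<open>
  The adjoint for the real inner product. It makes sense for every bounded real-linear map, which
  avoids side conditions in calculations, and agrees with \<^const>\<open>op_adj\<close> on \<^const>\<open>BH\<close>.
\<close>

definition adj :: "('a::{real_inner, complete_space} \<Rightarrow>\<^sub>L 'a) \<Rightarrow> ('a \<Rightarrow>\<^sub>L 'a)" where
  "adj f = (SOME g. \<forall>x y. inner (blinfun_apply f x) y = inner x (blinfun_apply g y))"

lemma inner_apply_adj: "inner (blinfun_apply f x) y = inner x (blinfun_apply (adj f) y)"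
proof -
  have "\<exists>z. \<forall>x. inner (f x) y = inner x z" for y
    by (rule riesz_representation) (intro bounded_linear_intros)
  then obtain G where G: "\<And>x y. inner (f x) y = inner x (G y)"
    by metis
  have eqI: "u = v" if "\<And>x. inner x u = inner x v" for u v :: 'a
    using that[of "u - v"] by (metis inner_diff_right inner_eq_zero_iff eq_iff_diff_eq_0)
  have "norm (G y) \<le> norm y * norm f" for y
  proof (cases "G y = 0")
    case False
    have "(norm (G y))\<^sup>2 = inner (f (G y)) y"
      by (simp add: G power2_norm_eq_inner)
    also have "\<dots> \<le> norm (f (G y)) * norm y"
      by (rule norm_cauchy_schwarz)
    also have "\<dots> \<le> (norm f * norm (G y)) * norm y"
      by (intro mult_right_mono norm_blinfun) simp
    finally show ?thesis using False by (simp add: power2_eq_square ac_simps)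
  qed simp
  then have "bounded_linear G"
    by (intro bounded_linear_intro[where K = "norm f"] eqI)
      (simp_all add: G[symmetric] inner_add_right)
  then have "\<exists>g. \<forall>x y. inner (f x) y = inner x (blinfun_apply g y)"
    using G bounded_linear_Blinfun_apply by (metis (full_types))
  then show ?thesis
    unfolding adj_def by (rule someI2_ex) blast
qed

lemma adj_inner: "inner (blinfun_apply (adj f) x) y = inner x (blinfun_apply f y)"
  by (metis inner_apply_adj inner_commute)

lemma norm_le_of_inner_le:
  fixes u :: "'a::real_inner"
  assumes "0 \<le> K" "\<And>v. inner u v \<le> K * norm v"
  shows "norm u \<le> K"
  using assms(2)[of u] assms(1)
  by (cases "u = 0") (simp_all add: power2_norm_eq_inner[symmetric] power2_eq_square)

lemma norm_adj_apply_le: "norm (blinfun_apply (adj f) v) \<le> norm f * norm v"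
proof (rule norm_le_of_inner_le)
  fix w
  have "inner (adj f v) w \<le> norm v * norm (f w)"
    unfolding adj_inner by (rule norm_cauchy_schwarz)
  also have "\<dots> \<le> norm v * (norm f * norm w)"
    by (intro mult_left_mono norm_blinfun) simp
  finally show "inner (adj f v) w \<le> norm f * norm v * norm w"
    by (simp add: ac_simps)
qed simp

lemma norm_adj_le: "norm (adj f) \<le> norm f"
  by (rule norm_blinfun_bound) (simp_all add: norm_adj_apply_le)

lemma adj_unique:
  assumes "\<And>x y. inner (blinfun_apply f x) y = inner x (blinfun_apply g y)"
  shows "adj f = g"
proof (rule blinfun_eqI)
  fix y
  have "inner (adj f y - g y) (adj f y - g y) = 0"
    by (simp only: inner_diff_right[of _ "adj f y"] inner_apply_adj[symmetric] assms[symmetric])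
  then show "adj f y = g y" by simp
qed

lemma adj_adj [simp]: "adj (adj f) = f"
  by (rule adj_unique) (rule adj_inner)

lemma adj_compose: "adj (f o\<^sub>L g) = adj g o\<^sub>L adj f"
  by (rule adj_unique) (simp add: inner_apply_adj)

lemma adj_diff: "adj (f - g) = adj f - adj g"
  by (rule adj_unique) (simp add: inner_apply_adj blinfun.diff_left inner_diff_left inner_diff_right)

lemma adj_add: "adj (f + g) = adj f + adj g"
  by (rule adj_unique) (simp add: inner_apply_adj blinfun.add_left inner_add_left inner_add_right)

lemma adj_scaleR: "adj (r *\<^sub>R f) = r *\<^sub>R adj f"
  by (rule adj_unique) (simp add: inner_apply_adj blinfun.scaleR_left)

lemma norm_adj [simp]: "norm (adj f) = norm f"
  using norm_adj_le[of f] norm_adj_le[of "adj f"] by simp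

lemma cinner_eq_inner:
  fixes x y :: "'a::chilbert_space"
  shows "cinner x y = Complex (inner x y) (- inner (\<i> *\<^sub>C x) y)"
proof (rule complex_eqI)
  have "inner (\<i> *\<^sub>C x) y = Re (\<i> * cinner x y)"
    by (simp only: Re_cinner[symmetric] cinner_scaleC_left)
  then show "Im (cinner x y) = Im (Complex (inner x y) (- inner (\<i> *\<^sub>C x) y))"
    by simp
qed (simp add: Re_cinner)

text \<open>
  The imaginary part of the form is again a real inner product, with the first argument multiplied by
  \<open>\<i>\<close>; so for complex-linear maps adjointness for the real part implies adjointness for the form.
\<close>

lemma op_adj_eq_adj:
  assumes "f \<in> BH"
  shows "op_adj f = adj f"
  unfolding op_adj_def
proof (rule the_equality)
  show "\<forall>x y. cinner (f x) y = cinner x (adj f y)"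
    using assms by (simp add: cinner_eq_inner BH_def inner_apply_adj[symmetric])
next
  fix g assume "\<forall>x y. cinner (f x) y = cinner x (blinfun_apply g y)"
  then have "inner (f x) y = inner x (g y)" for x y
    by (metis Re_cinner)
  then show "g = adj f" by (rule adj_unique[symmetric])
qed

lemma cinner_add_self: "cinner x y + cinner y x = complex_of_real (2 * inner x y)"
  for x y :: "'a::chilbert_space"
  using complex_add_cnj[of "cinner x y"] by (simp add: Re_cinner cinner_commute[symmetric])

lemma cinner_zero_left [simp]: "cinner 0 (y::'a::chilbert_space) = 0"
  using cinner_add_left[of 0 0 y] by simp

lemma cinner_sum_left: "cinner (\<Sum>i\<in>I. f i) (y::'a::chilbert_space) = (\<Sum>i\<in>I. cinner (f i) y)"
  by (induction I rule: infinite_finite_induct) (simp_all add: cinner_add_left)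

lemma cinner_adj_right:
  assumes "f \<in> BH"
  shows "cinner (blinfun_apply (adj f) x) y = cinner x (blinfun_apply f y)"
proof -
  have "cinner (f y) x = cinner y (adj f x)"
    using assms by (simp add: cinner_eq_inner BH_def inner_apply_adj[symmetric])
  then show ?thesis by (metis cinner_commute)
qed

lemma of_real_nonneg_iff: "complex_of_real r \<in> \<real>\<^sub>\<ge>\<^sub>0 \<longleftrightarrow> 0 \<le> r"
  by (simp add: complex_nonneg_Reals_iff)

text \<open>
  The quadratic form of \<open>a + a\<^sup>*\<close> is twice the real part of that of \<open>a\<close>. Positivity of \<open>a + a\<^sup>*\<close> thus
  becomes a statement about the real inner product alone.
\<close>

lemma mat_pos_real_part_iff:
  assumes "a \<in> mat_over n A" "A \<subseteq> BH"
  shows "mat_pos n (mat_add a (mat_adj a)) \<longleftrightarrow>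
    (\<forall>v. 0 \<le> (\<Sum>i<n. \<Sum>j<n. inner (blinfun_apply (a i j) (v j)) (v i)))"
proof -
  have "vec_cinner n (mat_apply n (mat_add a (mat_adj a)) v) v =
      complex_of_real (2 * (\<Sum>i<n. \<Sum>j<n. inner (a i j (v j)) (v i)))" for v
  proof -
    have adj: "op_adj (a j i) = adj (a j i)" "a j i \<in> BH" if "i < n" "j < n" for i j
      using assms that by (auto simp: mat_over_def intro!: op_adj_eq_adj)
    have "vec_cinner n (mat_apply n (mat_add a (mat_adj a)) v) v =
        (\<Sum>i<n. \<Sum>j<n. cinner (a i j (v j)) (v i)) + (\<Sum>i<n. \<Sum>j<n. cinner (v j) (a j i (v i)))"
      unfolding vec_cinner_def mat_apply_def mat_add_def mat_adj_def
      by (simp add: cinner_sum_left blinfun.add_left cinner_add_left sum.distrib adj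
          cinner_adj_right cong: sum.cong_simp)
    also have "(\<Sum>i<n. \<Sum>j<n. cinner (v j) (a j i (v i))) =
        (\<Sum>i<n. \<Sum>j<n. cinner (v i) (a i j (v j)))"
      by (rule sum.swap)
    also have "(\<Sum>i<n. \<Sum>j<n. cinner (a i j (v j)) (v i)) + \<dots> =
        (\<Sum>i<n. \<Sum>j<n. complex_of_real (2 * inner (a i j (v j)) (v i)))"
      by (simp only: sum.distrib[symmetric] cinner_add_self)
    finally show ?thesis by (simp add: sum_distrib_left)
  qed
  then show ?thesis
    unfolding mat_pos_def by (simp add: of_real_nonneg_iff del: of_real_mult of_real_sum)
qed

lemma mat_real_pos_elems_iff:
  assumes "A \<subseteq> BH"
  shows "a \<in> mat_real_pos_elems n A \<longleftrightarrow> a \<in> mat_over n A \<and>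
    (\<forall>v. 0 \<le> (\<Sum>i<n. \<Sum>j<n. inner (blinfun_apply (a i j) (v j)) (v i)))"
  using mat_pos_real_part_iff[OF _ assms] by (auto simp: mat_real_pos_elems_def)

lemma real_pos_elems_iff:
  assumes "A \<subseteq> BH"
  shows "a \<in> real_pos_elems A \<longleftrightarrow> a \<in> A \<and> (\<forall>v. 0 \<le> inner (blinfun_apply a v) v)"
proof -
  have "op_pos (a + op_adj a) \<longleftrightarrow> (\<forall>v. 0 \<le> inner (a v) v)" if "a \<in> A"
  proof -
    have "a \<in> BH" using that assms by auto
    then have "cinner ((a + op_adj a) v) v = complex_of_real (2 * inner (a v) v)" for v
      by (simp only: op_adj_eq_adj blinfun.add_left cinner_add_left cinner_adj_right
          cinner_add_self)
    then show ?thesis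
      unfolding op_pos_def by (simp add: of_real_nonneg_iff del: of_real_mult)
  qed
  then show ?thesis by (auto simp: real_pos_elems_def)
qed

lemma op_scaleC_op_scaleC: "op_scaleC c (op_scaleC d f) = op_scaleC (c * d) f"
  by (rule blinfun_eqI) (simp add: op_scaleC.rep_eq scaleC_scaleC)

lemma op_scaleC_add: "op_scaleC c (f + g) = op_scaleC c f + op_scaleC c g"
  by (rule blinfun_eqI) (simp add: op_scaleC.rep_eq blinfun.add_left scaleC_add_right)

lemma op_scaleC_of_real: "op_scaleC (complex_of_real r) f = r *\<^sub>R f"
  by (rule blinfun_eqI) (simp add: op_scaleC.rep_eq scaleC_of_real blinfun.scaleR_left)

lemma op_scaleC_one: "op_scaleC 1 f = f"
  using op_scaleC_of_real[of 1 f] by simp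

section \<open>Approximate units and accretive elements\<close>

instance chilbert_space \<subseteq> banach ..

lemma norm_sq_le_of_apply:
  fixes f :: "'a::real_normed_vector \<Rightarrow>\<^sub>L 'b::real_normed_vector"
  assumes "0 \<le> K" "\<And>v. (norm (blinfun_apply f v))\<^sup>2 \<le> K * (norm v)\<^sup>2"
  shows "(norm f)\<^sup>2 \<le> K"
proof -
  have "norm f \<le> sqrt K"
  proof (rule norm_blinfun_bound)
    show "norm (f v) \<le> sqrt K * norm v" for v
      using real_sqrt_le_mono[OF assms(2)[of v]] by (simp add: real_sqrt_mult)
  qed (use assms in simp)
  then have "(norm f)\<^sup>2 \<le> (sqrt K)\<^sup>2"
    by (intro power_mono) auto
  then show ?thesis using assms(1) by simp
qed

lemma norm_apply_le_norm:
  fixes f :: "'a::real_normed_vector \<Rightarrow>\<^sub>L 'b::real_normed_vector"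
  assumes "norm f \<le> K"
  shows "norm (blinfun_apply f v) \<le> K * norm v"
  using norm_blinfun[of f v] mult_right_mono[OF assms, of "norm v"] by simp

text \<open>
  For a contraction, \<open>\<parallel>y v - v\<parallel>\<^sup>2 = \<parallel>y v\<parallel>\<^sup>2 + \<parallel>v\<parallel>\<^sup>2 - 2 \<langle>y v, v\<rangle> \<le> 2 (\<parallel>v\<parallel>\<^sup>2 - \<langle>y v, v\<rangle>)\<close>. So a lower bound
  on the quadratic form alone controls the distance between \<open>y v\<close> and \<open>v\<close>.
\<close>

lemma contraction_near_fixed_vector:
  fixes y :: "'a::real_inner \<Rightarrow>\<^sub>L 'a"
  assumes "norm y \<le> 1"
  shows "(norm (blinfun_apply y v - v))\<^sup>2 \<le> 2 * inner (v - blinfun_apply y v) v"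
proof -
  have "(norm (y v))\<^sup>2 \<le> (norm v)\<^sup>2"
    using norm_apply_le_norm[OF assms, of v] by (intro power_mono) auto
  then show ?thesis
    by (simp add: power2_norm_eq_inner inner_diff_left inner_diff_right inner_commute)
qed

text \<open>
  A contraction and its adjoint have the same real quadratic form; hence \<open>y\<^sup>*\<close> is almost a unit for
  \<open>a\<close> wherever \<open>y\<close> is.
\<close>

lemma adj_left_unit:
  assumes "norm y \<le> 1"
  shows "(norm ((adj y o\<^sub>L a) - a))\<^sup>2 \<le> 2 * norm ((y o\<^sub>L a) - a) * norm a"
proof (rule norm_sq_le_of_apply)
  fix v
  let ?u = "blinfun_apply a v"
  have "(norm (adj y ?u - ?u))\<^sup>2 \<le> 2 * inner (?u - adj y ?u) ?u"
    using assms by (intro contraction_near_fixed_vector) simp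
  also have "inner (?u - adj y ?u) ?u = inner (?u - y ?u) ?u"
    using inner_commute[of ?u "y ?u"] by (simp add: inner_diff_left adj_inner)
  also have "\<dots> \<le> norm (?u - y ?u) * norm ?u"
    by (rule norm_cauchy_schwarz)
  also have "norm (?u - y ?u) = norm (((y o\<^sub>L a) - a) v)"
    by (simp add: blinfun.diff_left norm_minus_commute)
  also have "norm (((y o\<^sub>L a) - a) v) * norm ?u \<le>
      (norm ((y o\<^sub>L a) - a) * norm v) * (norm a * norm v)"
    by (intro mult_mono norm_blinfun) simp_all
  finally show "(norm (((adj y o\<^sub>L a) - a) v))\<^sup>2 \<le> 2 * norm ((y o\<^sub>L a) - a) * norm a * (norm v)\<^sup>2"
    by (simp add: blinfun.diff_left power2_eq_square ac_simps)
qed simp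

locale approx_unital_algebra =
  fixes A :: "'h::chilbert_space op set"
  assumes operator_algebra: "operator_algebra A"
    and approximately_unital: "approximately_unital A"
begin

lemma subset_BH: "A \<subseteq> BH"
  and closed: "closed A"
  and add_mem: "a \<in> A \<Longrightarrow> b \<in> A \<Longrightarrow> a + b \<in> A"
  and scaleC_mem: "a \<in> A \<Longrightarrow> op_scaleC c a \<in> A"
  and compose_mem: "a \<in> A \<Longrightarrow> b \<in> A \<Longrightarrow> a o\<^sub>L b \<in> A"
  using operator_algebra unfolding operator_algebra_def by auto

lemma scaleR_mem: "a \<in> A \<Longrightarrow> r *\<^sub>R a \<in> A"
  using scaleC_mem[of a "complex_of_real r"] by (simp add: op_scaleC_of_real)

lemma diff_mem: "a \<in> A \<Longrightarrow> b \<in> A \<Longrightarrow> a - b \<in> A"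
  using add_mem[of a "(-1) *\<^sub>R b"] scaleR_mem[of b "-1"] by simp

lemma contractive_unit:
  assumes "finite S" "S \<subseteq> A" "0 < \<delta>"
  shows "\<exists>e\<in>A. norm e \<le> 1 \<and> (\<forall>s\<in>S. norm ((e o\<^sub>L s) - s) \<le> \<delta> \<and> norm ((s o\<^sub>L e) - s) \<le> \<delta>)"
proof -
  obtain F where F: "F \<noteq> bot" "\<forall>\<^sub>F e in F. e \<in> A \<and> norm e \<le> 1"
      "\<And>a. a \<in> A \<Longrightarrow> ((\<lambda>e. e o\<^sub>L a) \<longlongrightarrow> a) F" "\<And>a. a \<in> A \<Longrightarrow> ((\<lambda>e. a o\<^sub>L e) \<longlongrightarrow> a) F"
    using approximately_unital unfolding approximately_unital_def by blast
  have "\<forall>\<^sub>F e in F. norm ((e o\<^sub>L s) - s) \<le> \<delta> \<and> norm ((s o\<^sub>L e) - s) \<le> \<delta>" if "s \<in> S" for s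
  proof -
    have "s \<in> A" using that assms(2) by blast
    then have "\<forall>\<^sub>F e in F. dist (e o\<^sub>L s) s < \<delta>" "\<forall>\<^sub>F e in F. dist (s o\<^sub>L e) s < \<delta>"
      using F(3,4) assms(3) by (auto intro: tendstoD)
    then show ?thesis
      by eventually_elim (simp add: dist_norm)
  qed
  then have "\<forall>\<^sub>F e in F. \<forall>s\<in>S. norm ((e o\<^sub>L s) - s) \<le> \<delta> \<and> norm ((s o\<^sub>L e) - s) \<le> \<delta>"
    using assms(1) by (simp add: eventually_ball_finite)
  then have "\<forall>\<^sub>F e in F. (e \<in> A \<and> norm e \<le> 1) \<and>
      (\<forall>s\<in>S. norm ((e o\<^sub>L s) - s) \<le> \<delta> \<and> norm ((s o\<^sub>L e) - s) \<le> \<delta>)"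
    using F(2) by (rule eventually_conj[rotated])
  then show ?thesis
    using eventually_happens'[OF F(1)] by blast
qed

text \<open>
  Choose \<open>y\<^sub>1\<close> with skew part \<open>k\<^sub>1 = y\<^sub>1 - y\<^sub>1\<^sup>*\<close>, then \<open>y\<^sub>2\<close> which is almost a unit for \<open>y\<^sub>1\<close> as well.
  All of \<open>y\<^sub>1 y\<^sub>2\<close>, \<open>y\<^sub>1 y\<^sub>2\<^sup>*\<close> are close to \<open>y\<^sub>1\<close> and \<open>y\<^sub>1\<^sup>* y\<^sub>2\<close>, \<open>y\<^sub>1\<^sup>* y\<^sub>2\<^sup>*\<close> are close to \<open>y\<^sub>1\<^sup>*\<close>, so
  \<open>k\<^sub>1 k\<^sub>2\<close> is almost zero and \<open>k\<^sub>1\<close>, \<open>k\<^sub>2\<close> have almost orthogonal ranges. By Pythagoras the skew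
  part of \<open>(y\<^sub>1 + y\<^sub>2) / 2\<close> is smaller by a factor of about \<open>1 / \<surd>2\<close>; the factor \<open>9/10\<close> leaves room for
  the errors.
\<close>

lemma nearly_selfadjoint_unit_geometric:
  assumes "finite S" "S \<subseteq> A" "0 < \<delta>"
  shows "\<exists>y\<in>A. norm y \<le> 1 \<and> norm (y - adj y) \<le> 2 * (9/10)^n \<and>
    (\<forall>s\<in>S. norm ((y o\<^sub>L s) - s) \<le> \<delta> \<and> norm ((s o\<^sub>L y) - s) \<le> \<delta>)"
  using assms
proof (induction n arbitrary: S \<delta>)
  case 0
  then obtain y where "y \<in> A" "norm y \<le> 1"
      "\<forall>s\<in>S. norm ((y o\<^sub>L s) - s) \<le> \<delta> \<and> norm ((s o\<^sub>L y) - s) \<le> \<delta>"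
    using contractive_unit by metis
  moreover have "norm (y - adj y) \<le> 2"
    using norm_triangle_ineq4[of y "adj y"] \<open>norm y \<le> 1\<close> by simp
  ultimately show ?case by auto
next
  case (Suc n)
  define c :: real where "c = 2 * (9/10)^n"
  have c: "0 < c" "c \<le> 2" by (simp_all add: c_def power_le_one)
  obtain y1 where y1: "y1 \<in> A" "norm y1 \<le> 1" "norm (y1 - adj y1) \<le> c"
      "\<And>s. s \<in> S \<Longrightarrow> norm ((y1 o\<^sub>L s) - s) \<le> \<delta>" "\<And>s. s \<in> S \<Longrightarrow> norm ((s o\<^sub>L y1) - s) \<le> \<delta>"
    using Suc unfolding c_def by metis
  (* The adjoint of y2 is a unit for y1 only up to a square root of the error of y2, hence the
     fourth power of c. *)
  define \<eta> where "\<eta> = min \<delta> (c^4 / 128)"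
  have \<eta>: "0 < \<eta>" "\<eta> \<le> \<delta>" "\<eta> \<le> c^4 / 128"
    using Suc.prems c by (auto simp: \<eta>_def)
  have "finite (insert y1 S)" "insert y1 S \<subseteq> A"
    using Suc.prems y1(1) by auto
  then obtain y2 where y2: "y2 \<in> A" "norm y2 \<le> 1" "norm (y2 - adj y2) \<le> c"
      "\<And>s. s \<in> insert y1 S \<Longrightarrow> norm ((y2 o\<^sub>L s) - s) \<le> \<eta>"
      "\<And>s. s \<in> insert y1 S \<Longrightarrow> norm ((s o\<^sub>L y2) - s) \<le> \<eta>"
    using Suc.IH[of "insert y1 S" \<eta>] \<eta>(1) unfolding c_def by metis
  have u: "norm ((y2 o\<^sub>L y1) - y1) \<le> \<eta>" "norm ((y1 o\<^sub>L y2) - y1) \<le> \<eta>"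
    using y2(4,5)[of y1] by auto
  have c2: "\<eta> \<le> c\<^sup>2 / 32"
  proof -
    have "c^4 = c\<^sup>2 * c\<^sup>2" by (simp add: power2_eq_square power4_eq_xxxx)
    also have "\<dots> \<le> c\<^sup>2 * 2\<^sup>2"
      using c by (intro mult_left_mono power_mono) auto
    finally show ?thesis using \<eta>(3) by simp
  qed
  have small: "d \<le> c\<^sup>2 / 8" if "0 \<le> d" "d\<^sup>2 \<le> 2 * r * s" "0 \<le> r" "r \<le> \<eta>" "s \<le> 1" for d r s :: real
  proof (rule power2_le_imp_le)
    have "2 * r * s \<le> 2 * r * 1" using that by (intro mult_left_mono) auto
    then have "d\<^sup>2 \<le> c^4 / 64" using that(2,4) \<eta>(3) by linarith
    also have "\<dots> = (c\<^sup>2 / 8)\<^sup>2" by (simp add: power2_eq_square power4_eq_xxxx)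
    finally show "d\<^sup>2 \<le> (c\<^sup>2 / 8)\<^sup>2" .
  qed simp
  (* The four products in the expansion of k1 k2, one by one. *)
  have adj_y2_left: "norm ((adj y2 o\<^sub>L y1) - y1) \<le> c\<^sup>2 / 8"
    by (rule small[OF norm_ge_zero adj_left_unit[OF y2(2)] norm_ge_zero u(1) y1(2)])
  have adj_eq: "(adj y2 o\<^sub>L adj y1) - adj y1 = adj ((y1 o\<^sub>L y2) - y1)"
    by (simp add: adj_diff adj_compose)
  have "(norm ((adj (adj y2) o\<^sub>L adj y1) - adj y1))\<^sup>2 \<le>
      2 * norm ((adj y2 o\<^sub>L adj y1) - adj y1) * norm (adj y1)"
    using y2(2) by (intro adj_left_unit) simp
  then have "(norm ((y2 o\<^sub>L adj y1) - adj y1))\<^sup>2 \<le> 2 * norm ((y1 o\<^sub>L y2) - y1) * norm y1"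
    by (simp add: adj_eq)
  then have y2_adj_left: "norm ((y2 o\<^sub>L adj y1) - adj y1) \<le> c\<^sup>2 / 8"
    using small[OF norm_ge_zero _ norm_ge_zero u(2) y1(2)] by blast
  let ?k1 = "y1 - adj y1" and ?k2 = "y2 - adj y2"
  have "?k1 o\<^sub>L ?k2 = (((y1 o\<^sub>L y2) - y1) - adj ((y2 o\<^sub>L adj y1) - adj y1))
      - (adj ((adj y2 o\<^sub>L y1) - y1) - adj ((y2 o\<^sub>L y1) - y1))"
    by (simp add: adj_diff adj_compose bounded_bilinear.diff_left[OF bounded_bilinear_blinfun_compose]
        bounded_bilinear.diff_right[OF bounded_bilinear_blinfun_compose])
  then have "norm (?k1 o\<^sub>L ?k2) \<le> (\<eta> + c\<^sup>2 / 8) + (c\<^sup>2 / 8 + \<eta>)"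
    using u adj_y2_left y2_adj_left
      norm_triangle_ineq4[of "((y1 o\<^sub>L y2) - y1) - adj ((y2 o\<^sub>L adj y1) - adj y1)"
        "adj ((adj y2 o\<^sub>L y1) - y1) - adj ((y2 o\<^sub>L y1) - y1)"]
      norm_triangle_ineq4[of "(y1 o\<^sub>L y2) - y1" "adj ((y2 o\<^sub>L adj y1) - adj y1)"]
      norm_triangle_ineq4[of "adj ((adj y2 o\<^sub>L y1) - y1)" "adj ((y2 o\<^sub>L y1) - y1)"]
    by (simp only: norm_adj)
  then have k12: "norm (?k1 o\<^sub>L ?k2) \<le> 62/100 * c\<^sup>2"
    using c2 zero_le_power2[of c] by linarith
  define y where "y = (1/2) *\<^sub>R (y1 + y2)"
  have skew: "y - adj y = (1/2) *\<^sub>R (?k1 + ?k2)"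
    by (simp add: y_def adj_scaleR adj_add algebra_simps)
  have "(norm (y - adj y))\<^sup>2 \<le> (9/10 * c)\<^sup>2"
  proof (rule norm_sq_le_of_apply)
    fix v
    have "(norm (?k1 v))\<^sup>2 \<le> (c * norm v)\<^sup>2" "(norm (?k2 v))\<^sup>2 \<le> (c * norm v)\<^sup>2"
      using norm_apply_le_norm[OF y1(3), of v] norm_apply_le_norm[OF y2(3), of v]
      by (auto intro: power_mono)
    moreover have "inner (?k1 v) (?k2 v) \<le> 62/100 * (c\<^sup>2 * (norm v)\<^sup>2)"
    proof -
      have "inner (?k1 v) w = - inner v (?k1 w)" for w
        by (simp add: blinfun.diff_left inner_diff_left inner_diff_right inner_apply_adj)
      then have "inner (?k1 v) (?k2 v) = inner v (- ((?k1 o\<^sub>L ?k2) v))"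
        by simp
      also have "\<dots> \<le> norm v * norm (- ((?k1 o\<^sub>L ?k2) v))"
        by (rule norm_cauchy_schwarz)
      also have "\<dots> \<le> norm v * (62/100 * c\<^sup>2 * norm v)"
        using norm_apply_le_norm[OF k12, of v] by (intro mult_left_mono) simp_all
      finally show ?thesis by (simp add: power2_eq_square ac_simps)
    qed
    moreover have "4 * (norm ((y - adj y) v))\<^sup>2 =
        (norm (?k1 v))\<^sup>2 + (norm (?k2 v))\<^sup>2 + 2 * inner (?k1 v) (?k2 v)"
      unfolding skew blinfun.scaleR_left blinfun.add_left
      by (simp add: power_divide power2_norm_eq_inner inner_add_left inner_add_right inner_commute)
    ultimately show "(norm ((y - adj y) v))\<^sup>2 \<le> (9/10 * c)\<^sup>2 * (norm v)\<^sup>2"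
      by (simp add: power_mult_distrib power_divide)
  qed simp
  then have "norm (y - adj y) \<le> 9/10 * c"
    by (rule power2_le_imp_le) (use c in simp)
  moreover have "y \<in> A"
    unfolding y_def by (intro scaleR_mem add_mem y1 y2)
  moreover have "norm y \<le> 1"
    unfolding y_def using norm_triangle_ineq[of y1 y2] y1(2) y2(2) by simp
  moreover have "norm ((y o\<^sub>L s) - s) \<le> \<delta> \<and> norm ((s o\<^sub>L y) - s) \<le> \<delta>" if "s \<in> S" for s
  proof -
    have "(y o\<^sub>L s) - s = (1/2) *\<^sub>R (((y1 o\<^sub>L s) - s) + ((y2 o\<^sub>L s) - s))"
      "(s o\<^sub>L y) - s = (1/2) *\<^sub>R (((s o\<^sub>L y1) - s) + ((s o\<^sub>L y2) - s))"
      unfolding y_def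
      by (rule blinfun_eqI, simp add: blinfun.add_left blinfun.diff_left blinfun.scaleR_left
          blinfun.add_right blinfun.scaleR_right algebra_simps flip: scaleR_add_left)+
    then show ?thesis
      using norm_triangle_ineq[of "(y1 o\<^sub>L s) - s" "(y2 o\<^sub>L s) - s"] y1(4)[OF that] y2(4)[of s]
        norm_triangle_ineq[of "(s o\<^sub>L y1) - s" "(s o\<^sub>L y2) - s"] y1(5)[OF that] y2(5)[of s] that \<eta>(2)
      by simp
  qed
  ultimately show ?case
    unfolding c_def by (intro bexI[of _ y]) auto
qed

lemma nearly_selfadjoint_unit:
  assumes "finite S" "S \<subseteq> A" "0 < \<delta>"
  shows "\<exists>y\<in>A. norm y \<le> 1 \<and> norm (y - adj y) \<le> \<delta> \<and>
    (\<forall>s\<in>S. norm ((y o\<^sub>L s) - s) \<le> \<delta> \<and> norm ((s o\<^sub>L y) - s) \<le> \<delta>)"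
proof -
  obtain n where "(9/10)^n < \<delta> / 2"
    using real_arch_pow_inv[of "\<delta> / 2" "9/10"] assms(3) by auto
  then show ?thesis
    using nearly_selfadjoint_unit_geometric[OF assms, of n] by fastforce
qed

text \<open>
  For an almost selfadjoint unit \<open>y\<close> one has \<open>y\<^sup>* a y \<approx> a\<close> and \<open>y\<^sup>2 \<approx> y\<^sup>* y\<close>. In terms of quadratic forms,
  \<open>a\<close> may be evaluated at \<open>y v\<close>, and \<open>y\<^sup>2\<close>, which unlike \<open>y\<^sup>* y\<close> lies in the algebra, has the form
  \<open>\<parallel>y v\<parallel>\<^sup>2\<close>.
\<close>

lemma compressing_unit:
  assumes "finite S" "S \<subseteq> A" "a \<in> A" "0 < \<delta>"
  shows "\<exists>y\<in>A. norm y \<le> 1 \<and> (\<forall>s\<in>S. norm ((y o\<^sub>L y o\<^sub>L s) - s) \<le> \<delta>) \<and>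
    (\<forall>v. \<bar>inner (blinfun_apply a v) v - inner (blinfun_apply a (blinfun_apply y v)) (blinfun_apply y v)\<bar>
      \<le> \<delta> * (norm v)\<^sup>2) \<and>
    (\<forall>v. \<bar>inner (blinfun_apply (y o\<^sub>L y) v) v - (norm (blinfun_apply y v))\<^sup>2\<bar> \<le> \<delta> * (norm v)\<^sup>2)"
proof -
  define c where "c = \<delta> / (3 + norm a)"
  have c: "0 < c" using assms(4) by (simp add: c_def add_pos_nonneg)
  have c2: "(3 + norm a) * c = \<delta>"
    unfolding c_def using norm_ge_zero[of a] by (simp add: add_nonneg_eq_0_iff)
  then have c3: "3 * c + norm a * c = \<delta>" by (simp add: algebra_simps)
  have nac: "0 \<le> norm a * c" using c by simp
  have c4: "2 * c \<le> \<delta>" "c \<le> \<delta>" using c3 nac c by linarith+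
  obtain y where y: "y \<in> A" "norm y \<le> 1" "norm (y - adj y) \<le> c"
      "\<And>s. s \<in> insert a S \<Longrightarrow> norm ((y o\<^sub>L s) - s) \<le> c"
      "\<And>s. s \<in> insert a S \<Longrightarrow> norm ((s o\<^sub>L y) - s) \<le> c"
    using nearly_selfadjoint_unit[of "insert a S" c] assms c by auto
  have "norm ((y o\<^sub>L y o\<^sub>L s) - s) \<le> \<delta>" if "s \<in> S" for s
  proof -
    have 1: "norm (y o\<^sub>L ((y o\<^sub>L s) - s)) \<le> 1 * c"
      using y(2) y(4)[of s] that c
      by (intro order_trans[OF norm_blinfun_compose] mult_mono) auto
    have eq: "(y o\<^sub>L y o\<^sub>L s) - s = (y o\<^sub>L ((y o\<^sub>L s) - s)) + ((y o\<^sub>L s) - s)"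
      by (rule blinfun_eqI) (simp add: blinfun.add_left blinfun.diff_left blinfun.diff_right)
    have "norm ((y o\<^sub>L s) - s) \<le> c"
      using y(4) that by simp
    then show ?thesis
      unfolding eq
      using 1 norm_triangle_ineq[of "y o\<^sub>L ((y o\<^sub>L s) - s)" "(y o\<^sub>L s) - s"] c4
      by linarith
  qed
  moreover have "\<bar>inner (a v) v - inner (a (y v)) (y v)\<bar> \<le> \<delta> * (norm v)\<^sup>2" for v
  proof -
    let ?D = "a - (adj y o\<^sub>L a o\<^sub>L y)"
    have eq: "?D = ((y - adj y) o\<^sub>L a) - (adj y o\<^sub>L ((a o\<^sub>L y) - a)) - ((y o\<^sub>L a) - a)"
      by (rule blinfun_eqI)
        (simp add: blinfun.diff_left blinfun.diff_right)
    have "norm (adj y o\<^sub>L ((a o\<^sub>L y) - a)) \<le> 1 * c"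
      using y(2) y(5)[of a] c
      by (intro order_trans[OF norm_blinfun_compose] mult_mono) auto
    moreover have "norm ((y - adj y) o\<^sub>L a) \<le> c * norm a"
      using y(3) c by (intro order_trans[OF norm_blinfun_compose] mult_mono) auto
    moreover have "norm ((y o\<^sub>L a) - a) \<le> c"
      using y(4) by simp
    ultimately have D: "norm ?D \<le> \<delta>"
      unfolding eq using c c3[unfolded mult.commute[of "norm a"]]
        norm_triangle_ineq4[of "((y - adj y) o\<^sub>L a) - (adj y o\<^sub>L ((a o\<^sub>L y) - a))" "(y o\<^sub>L a) - a"]
        norm_triangle_ineq4[of "(y - adj y) o\<^sub>L a" "adj y o\<^sub>L ((a o\<^sub>L y) - a)"]
      by linarith
    have "inner (a v) v - inner (a (y v)) (y v) = inner (?D v) v"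
      by (simp add: blinfun.diff_left inner_diff_left adj_inner)
    also have "\<bar>\<dots>\<bar> \<le> norm (?D v) * norm v"
      by (rule Cauchy_Schwarz_ineq2)
    also have "\<dots> \<le> (\<delta> * norm v) * norm v"
      by (intro mult_right_mono norm_apply_le_norm D) simp
    finally show ?thesis by (simp add: power2_eq_square ac_simps)
  qed
  moreover have "\<bar>inner ((y o\<^sub>L y) v) v - (norm (y v))\<^sup>2\<bar> \<le> \<delta> * (norm v)\<^sup>2" for v
  proof -
    have "inner ((y o\<^sub>L y) v) v - (norm (y v))\<^sup>2 = - inner (y v) ((y - adj y) v)"
      by (simp add: inner_apply_adj[of y "y v" v] power2_norm_eq_inner blinfun.diff_left
          inner_diff_right)
    also have "\<bar>\<dots>\<bar> \<le> norm (y v) * norm ((y - adj y) v)"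
      by (simp add: Cauchy_Schwarz_ineq2)
    also have "\<dots> \<le> (1 * norm v) * (c * norm v)"
      using c by (intro mult_mono norm_apply_le_norm y) auto
    also have "\<dots> \<le> \<delta> * (norm v)\<^sup>2"
      using mult_right_mono[OF c4(2), of "(norm v)\<^sup>2"] by (simp add: power2_eq_square ac_simps)
    finally show ?thesis .
  qed
  ultimately show ?thesis
    using y(1,2) by blast
qed

text \<open>
  The correction is \<open>\<epsilon> y\<^sup>2\<close>, with form close to \<open>\<epsilon> \<parallel>y v\<parallel>\<^sup>2\<close>, whereas the form of \<open>x\<close> at \<open>v\<close> is close to its
  form at \<open>y v\<close> and hence almost at least \<open>- \<epsilon> \<parallel>y v\<parallel>\<^sup>2\<close>. The remaining error is as small as desired.
\<close>

lemma accretive_improvement: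
  assumes "x \<in> A" "0 < \<epsilon>" and lower: "\<And>v. - \<epsilon> * (norm v)\<^sup>2 \<le> inner (blinfun_apply x v) v"
  shows "\<exists>x'\<in>A. norm (x' - x) \<le> \<epsilon> \<and>
    (\<forall>v. - (\<epsilon> / 2) * (norm v)\<^sup>2 \<le> inner (blinfun_apply x' v) v)"
proof -
  define \<delta> where "\<delta> = (\<epsilon> / 2) / (1 + \<epsilon>)"
  have \<delta>: "0 < \<delta>" "\<delta> + \<epsilon> * \<delta> = \<epsilon> / 2"
  proof -
    have "1 + \<epsilon> \<noteq> 0" using assms(2) by simp
    then have "\<delta> * (1 + \<epsilon>) = \<epsilon> / 2"
      using \<delta>_def by (rule iffD1[OF nonzero_eq_divide_eq])
    then show "\<delta> + \<epsilon> * \<delta> = \<epsilon> / 2" by (simp add: algebra_simps)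
  qed (use assms(2) in \<open>simp add: \<delta>_def\<close>)
  obtain y where y: "y \<in> A" "norm y \<le> 1"
    "\<And>v. \<bar>inner (x v) v - inner (x (y v)) (y v)\<bar> \<le> \<delta> * (norm v)\<^sup>2"
    "\<And>v. \<bar>inner ((y o\<^sub>L y) v) v - (norm (y v))\<^sup>2\<bar> \<le> \<delta> * (norm v)\<^sup>2"
    using compressing_unit[of "{}" x \<delta>] assms(1) \<delta>(1) by auto
  let ?x' = "x + \<epsilon> *\<^sub>R (y o\<^sub>L y)"
  have "?x' \<in> A"
    by (intro add_mem scaleR_mem compose_mem assms y)
  moreover have "norm (?x' - x) \<le> \<epsilon>"
  proof -
    have "norm (y o\<^sub>L y) \<le> 1 * 1"
      using y(2) by (intro order_trans[OF norm_blinfun_compose] mult_mono) auto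
    then show ?thesis using assms(2) mult_left_mono[of "norm (y o\<^sub>L y)" 1 \<epsilon>] by simp
  qed
  moreover have "- (\<epsilon> / 2) * (norm v)\<^sup>2 \<le> inner (?x' v) v" for v
  proof -
    have "inner ((y o\<^sub>L y) v) v \<ge> (norm (y v))\<^sup>2 - \<delta> * (norm v)\<^sup>2"
      using y(4)[of v] by linarith
    then have "\<epsilon> * inner ((y o\<^sub>L y) v) v \<ge> \<epsilon> * ((norm (y v))\<^sup>2 - \<delta> * (norm v)\<^sup>2)"
      using assms(2) by (intro mult_left_mono) auto
    moreover have "inner (x v) v \<ge> - \<epsilon> * (norm (y v))\<^sup>2 - \<delta> * (norm v)\<^sup>2"
      using y(3)[of v] lower[of "y v"] by linarith
    moreover have "inner (?x' v) v = inner (x v) v + \<epsilon> * inner ((y o\<^sub>L y) v) v"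
      by (simp add: blinfun.add_left blinfun.scaleR_left inner_add_left)
    moreover have "(\<epsilon> / 2) * (norm v)\<^sup>2 = \<delta> * (norm v)\<^sup>2 + \<epsilon> * (\<delta> * (norm v)\<^sup>2)"
      using \<delta>(2) by (metis distrib_right mult.assoc)
    ultimately show ?thesis unfolding right_diff_distrib by linarith
  qed
  ultimately show ?thesis by blast
qed

text \<open>
  Iterating the previous improvement gives corrections of norms \<open>\<epsilon>, \<epsilon>/2, \<epsilon>/4, \<dots>\<close> with sum \<open>2 \<epsilon>\<close>.
\<close>

lemma accretive_approximation:
  assumes "x \<in> A" "0 < \<epsilon>" and lower: "\<And>v. - \<epsilon> * (norm v)\<^sup>2 \<le> inner (blinfun_apply x v) v"
  shows "\<exists>z\<in>A. (\<forall>v. 0 \<le> inner (blinfun_apply z v) v) \<and> norm (z - x) \<le> 2 * \<epsilon>"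
proof -
  have "\<exists>X. \<forall>n. (X n \<in> A \<and> (\<forall>v. - (\<epsilon> * (1/2)^n) * (norm v)\<^sup>2 \<le> inner (blinfun_apply (X n) v) v) \<and>
      (n = 0 \<longrightarrow> X n = x)) \<and> norm (X (Suc n) - X n) \<le> \<epsilon> * (1/2)^n"
  proof (rule dependent_nat_choice)
    show "\<exists>y. y \<in> A \<and> (\<forall>v. - (\<epsilon> * (1/2)^0) * (norm v)\<^sup>2 \<le> inner (blinfun_apply y v) v) \<and>
        ((0::nat) = 0 \<longrightarrow> y = x)"
      using assms by (intro exI[of _ x]) simp
  next
    fix y and n :: nat
    assume y: "y \<in> A \<and> (\<forall>v. - (\<epsilon> * (1/2)^n) * (norm v)\<^sup>2 \<le> inner (blinfun_apply y v) v) \<and>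
        (n = 0 \<longrightarrow> y = x)"
    have "0 < \<epsilon> * (1/2)^n" using assms(2) by simp
    from accretive_improvement[OF _ this, of y] y
    obtain y' where "y' \<in> A" "norm (y' - y) \<le> \<epsilon> * (1/2)^n"
        "\<And>v. - (\<epsilon> * (1/2)^n / 2) * (norm v)\<^sup>2 \<le> inner (blinfun_apply y' v) v"
      by blast
    then show "\<exists>y'. (y' \<in> A \<and> (\<forall>v. - (\<epsilon> * (1/2)^Suc n) * (norm v)\<^sup>2 \<le> inner (blinfun_apply y' v) v) \<and>
        (Suc n = 0 \<longrightarrow> y' = x)) \<and> norm (y' - y) \<le> \<epsilon> * (1/2)^n"
      by (intro exI[of _ y']) simp
  qed
  then obtain X where X: "\<And>n. X n \<in> A" "X 0 = x"
      "\<And>n v. - (\<epsilon> * (1/2)^n) * (norm v)\<^sup>2 \<le> inner (blinfun_apply (X n) v) v"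
      "\<And>n. norm (X (Suc n) - X n) \<le> \<epsilon> * (1/2)^n"
    by blast
  have geo: "(\<lambda>n. \<epsilon> * (1/2)^n) sums (2 * \<epsilon>)"
    using sums_mult[OF geometric_sums[of "1/2::real"], of \<epsilon>] by (simp add: mult.commute)
  have sumn: "summable (\<lambda>n. norm (X (Suc n) - X n))"
    by (rule summable_comparison_test[OF _ sums_summable[OF geo]]) (use X(4) in auto)
  have "(\<lambda>n. X n - X 0) \<longlonglongrightarrow> (\<Sum>n. X (Suc n) - X n)"
    using summable_LIMSEQ[OF summable_norm_cancel[OF sumn]] by (simp add: sum_lessThan_telescope)
  from tendsto_add[OF this tendsto_const[of "X 0"]]
  have lim: "X \<longlonglongrightarrow> (\<Sum>n. X (Suc n) - X n) + x" (is "_ \<longlonglongrightarrow> ?z")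
    by (simp add: X(2))
  have "?z \<in> A"
    by (rule closed_sequentially[OF closed X(1) lim])
  moreover have "norm (?z - x) \<le> 2 * \<epsilon>"
  proof -
    have "norm (\<Sum>n. X (Suc n) - X n) \<le> (\<Sum>n. norm (X (Suc n) - X n))"
      by (rule summable_norm[OF sumn])
    also have "\<dots> \<le> (\<Sum>n. \<epsilon> * (1/2)^n)"
      by (rule suminf_le[OF X(4) sumn sums_summable[OF geo]])
    also have "\<dots> = 2 * \<epsilon>"
      using geo by (simp add: sums_iff)
    finally show ?thesis by simp
  qed
  moreover have "0 \<le> inner (blinfun_apply ?z v) v" for v
  proof (rule tendsto_le[OF sequentially_bot])
    show "(\<lambda>n. inner (blinfun_apply (X n) v) v) \<longlonglongrightarrow> inner (blinfun_apply ?z v) v"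
      by (intro tendsto_intros lim)
    have "(\<lambda>n. (1/2)^n) \<longlonglongrightarrow> (0::real)"
      by (rule LIMSEQ_realpow_zero) simp_all
    then have "(\<lambda>n. - (\<epsilon> * (1/2)^n) * (norm v)\<^sup>2) \<longlonglongrightarrow> - (\<epsilon> * 0) * (norm v)\<^sup>2"
      by (intro tendsto_intros) simp
    then show "(\<lambda>n. - (\<epsilon> * (1/2)^n) * (norm v)\<^sup>2) \<longlonglongrightarrow> 0" by simp
  qed (use X(3) in auto)
  ultimately show ?thesis by blast
qed

end

section \<open>Columns and Moebius maps\<close>

text \<open>
  The column with entries \<open>f\<close> and \<open>g\<close>, as an operator into the Hilbert sum of two copies of the
  target.
\<close>

definition col :: "('a::real_normed_vector \<Rightarrow>\<^sub>L 'b::real_normed_vector) \<Rightarrow> ('a \<Rightarrow>\<^sub>L 'b) \<Rightarrow>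
    ('a \<Rightarrow>\<^sub>L ('b \<times> 'b))"
  where "col f g = Blinfun (\<lambda>v. (blinfun_apply f v, blinfun_apply g v))"

lemma col_apply: "blinfun_apply (col f g) v = (blinfun_apply f v, blinfun_apply g v)"
  unfolding col_def
  by (subst bounded_linear_Blinfun_apply) (intro bounded_linear_Pair blinfun.bounded_linear_right, rule refl)

lemma col_add: "col (f + f') (g + g') = col f g + col f' g'"
  by (rule blinfun_eqI) (simp add: col_apply blinfun.add_left)

lemma norm_col_apply_sq:
  "(norm (blinfun_apply (col f g) v))\<^sup>2 = (norm (blinfun_apply f v))\<^sup>2 + (norm (blinfun_apply g v))\<^sup>2"
  by (simp add: col_apply norm_Pair)

lemma norm_col_leI:
  assumes "0 \<le> K"
    "\<And>v. (norm (blinfun_apply f v))\<^sup>2 + (norm (blinfun_apply g v))\<^sup>2 \<le> K\<^sup>2 * (norm v)\<^sup>2"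
  shows "norm (col f g) \<le> K"
proof (rule power2_le_imp_le)
  show "(norm (col f g))\<^sup>2 \<le> K\<^sup>2"
    by (rule norm_sq_le_of_apply) (use assms in \<open>auto simp: norm_col_apply_sq\<close>)
qed fact

lemma norm_col_leD:
  assumes "norm (col f g) \<le> K"
  shows "(norm (blinfun_apply f v))\<^sup>2 + (norm (blinfun_apply g v))\<^sup>2 \<le> K\<^sup>2 * (norm v)\<^sup>2"
proof -
  have "(norm (col f g v))\<^sup>2 \<le> (K * norm v)\<^sup>2"
    using norm_apply_le_norm[OF assms, of v] by (intro power_mono) auto
  then show ?thesis by (simp add: norm_col_apply_sq power_mult_distrib)
qed

lemma norm_le_norm_col: "norm f \<le> norm (col f g)" "norm g \<le> norm (col f g)"
proof -
  have "norm (f v) \<le> norm (col f g) * norm v \<and> norm (g v) \<le> norm (col f g) * norm v" for v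
    using norm_blinfun[of "col f g" v] norm_fst_le[of "f v" "g v"] norm_snd_le[of "g v" "f v"]
    by (auto simp: col_apply)
  then show "norm f \<le> norm (col f g)" "norm g \<le> norm (col f g)"
    by (auto intro: norm_blinfun_bound)
qed

lemma norm_col_zero [simp]: "norm (col f 0) = norm f"
proof (rule antisym)
  show "norm (col f 0) \<le> norm f"
    using norm_apply_le_norm[OF order_refl, of f]
    by (intro norm_col_leI) (auto simp flip: power_mult_distrib intro: power_mono)
qed (rule norm_le_norm_col)

lemma norm_col_le_add: "norm (col f g) \<le> norm f + norm g"
proof (rule norm_blinfun_bound)
  fix v
  have "norm (col f g v) \<le> norm (f v) + norm (g v)"
    by (simp add: col_apply norm_Pair_le)
  also have "\<dots> \<le> norm f * norm v + norm g * norm v"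
    by (intro add_mono norm_blinfun)
  finally show "norm (col f g v) \<le> (norm f + norm g) * norm v"
    by (simp add: distrib_right)
qed simp

lemma norm_col_perturb:
  assumes "norm (col f g) \<le> K" "norm (f' - f) \<le> d1" "norm (g' - g) \<le> d2"
  shows "norm (col f' g') \<le> K + d1 + d2"
proof -
  have "col f' g' = col f g + col (f' - f) (g' - g)"
    by (simp flip: col_add)
  then show ?thesis
    using norm_triangle_ineq[of "col f g" "col (f' - f) (g' - g)"]
      norm_col_le_add[of "f' - f" "g' - g"] assms
    by (simp add: add_increasing2)
qed

lemma norm_col_compose_left_le:
  assumes "norm e \<le> 1"
  shows "norm (col (e o\<^sub>L f) (e o\<^sub>L g)) \<le> norm (col f g)"
proof (rule norm_col_leI)
  fix v
  have "(norm (e u))\<^sup>2 \<le> (norm u)\<^sup>2" for u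
    using norm_apply_le_norm[OF assms, of u] by (intro power_mono) auto
  from this[of "f v"] this[of "g v"]
  show "(norm ((e o\<^sub>L f) v))\<^sup>2 + (norm ((e o\<^sub>L g) v))\<^sup>2 \<le> (norm (col f g))\<^sup>2 * (norm v)\<^sup>2"
    using norm_col_leD[of f g "norm (col f g)" v] unfolding blinfun_apply_blinfun_compose
    by linarith
qed simp

lemma norm_col_op_scaleC:
  "norm (col (op_scaleC c f) (op_scaleC c g)) = cmod c * norm (col f g)"
proof -
  have le: "norm (col (op_scaleC c f) (op_scaleC c g)) \<le> cmod c * norm (col f g)" for c f g
  proof (rule norm_col_leI)
    fix v
    show "(norm (op_scaleC c f v))\<^sup>2 + (norm (op_scaleC c g v))\<^sup>2 \<le>
        (cmod c * norm (col f g))\<^sup>2 * (norm v)\<^sup>2"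
      using mult_left_mono[OF norm_col_leD[of f g "norm (col f g)" v], of "(cmod c)\<^sup>2"]
      by (simp add: op_scaleC.rep_eq norm_scaleC power_mult_distrib distrib_left ac_simps)
  qed simp
  show ?thesis
  proof (cases "c = 0")
    case True
    then show ?thesis using le[of c f g] by simp
  next
    case False
    have inv: "op_scaleC (inverse c) (op_scaleC c h) = h" for h
      by (rule blinfun_eqI) (use False scaleC_of_real[of 1] in
          \<open>simp add: op_scaleC.rep_eq scaleC_scaleC\<close>)
    have "norm (col f g) \<le> cmod (inverse c) * norm (col (op_scaleC c f) (op_scaleC c g))"
      using le[of "inverse c" "op_scaleC c f" "op_scaleC c g"] by (simp add: inv)
    then have "cmod c * norm (col f g) \<le> norm (col (op_scaleC c f) (op_scaleC c g))"
      using False by (simp add: norm_divide divide_simps mult.commute)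
    then show ?thesis using le[of c f g] by simp
  qed
qed

text \<open>
  The Moebius transformation \<open>x \<mapsto> (x + t) (1 + t x)\<^sup>-\<^sup>1\<close> preserves the unit ball since
  \<open>\<parallel>(x + t) w\<parallel>\<^sup>2 - \<parallel>(1 + t x) w\<parallel>\<^sup>2 = (1 - t\<^sup>2) (\<parallel>x w\<parallel>\<^sup>2 - \<parallel>w\<parallel>\<^sup>2)\<close>. Taking \<open>w = (1 - t x) v\<close> replaces the
  inverse by its first-order approximation and turns \<open>(1 + t x) w\<close> into \<open>(1 - t\<^sup>2 x\<^sup>2) v\<close>. A second entry
  \<open>y\<close> rides along, because a contractive column leaves it the room \<open>\<parallel>w\<parallel>\<^sup>2 - \<parallel>x w\<parallel>\<^sup>2\<close>. The slack \<open>\<rho> - 1\<close>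
  allows columns that are only almost contractive.
\<close>

lemma moebius_column:
  fixes x y :: "'a::real_inner \<Rightarrow>\<^sub>L 'a"
  assumes "norm (col x y) \<le> \<rho>" "1 \<le> \<rho>" "\<rho> \<le> 2" "\<bar>t\<bar> \<le> 1"
  shows "norm (col (x + t *\<^sub>R (id_blinfun - (x o\<^sub>L x))) (y - t *\<^sub>R (y o\<^sub>L x)))
    \<le> 1 + 24 * t\<^sup>2 + 14 * (\<rho> - 1)"
proof -
  define K where "K = 1 + 22 * t\<^sup>2 + 14 * (\<rho> - 1)"
  have nx: "norm x \<le> 2" using norm_le_norm_col(1)[of x y] assms by linarith
  have nxv: "norm (x v) \<le> 2 * norm v" for v
    by (rule norm_apply_le_norm[OF nx])
  have t2: "t\<^sup>2 \<le> 1" using assms(4) by (simp add: abs_square_le_1)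
  have "norm (col (x + t *\<^sub>R (id_blinfun - (x o\<^sub>L x)) - t\<^sup>2 *\<^sub>R x) (y - t *\<^sub>R (y o\<^sub>L x))) \<le> K"
  proof (rule norm_col_leI)
    show "0 \<le> K" unfolding K_def using assms(2) by (intro add_nonneg_nonneg mult_nonneg_nonneg) auto
    fix v
    define w where "w = v - t *\<^sub>R x v"
    have sw: "(norm (x w))\<^sup>2 + (norm (y w))\<^sup>2 \<le> \<rho>\<^sup>2 * (norm w)\<^sup>2"
      by (rule norm_col_leD) fact
    have identity: "(norm (x w + t *\<^sub>R w))\<^sup>2 + (norm (y w))\<^sup>2 = (norm (w + t *\<^sub>R x w))\<^sup>2
        + (1 - t\<^sup>2) * ((norm (x w))\<^sup>2 + (norm (y w))\<^sup>2 - (norm w)\<^sup>2) + t\<^sup>2 * (norm (y w))\<^sup>2"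
      unfolding power2_norm_eq_inner
      by (simp add: inner_add_left inner_add_right inner_commute algebra_simps power2_eq_square)
    have "norm (t *\<^sub>R x v) \<le> 1 * (2 * norm v)"
      unfolding norm_scaleR using assms(4) nxv by (intro mult_mono) auto
    then have nw: "norm w \<le> 3 * norm v"
      unfolding w_def using norm_triangle_ineq4[of v "t *\<^sub>R x v"] by linarith
    have "(norm w)\<^sup>2 \<le> (3 * norm v)\<^sup>2" by (rule power_mono[OF nw]) simp
    then have nw2: "(norm w)\<^sup>2 \<le> 9 * (norm v)\<^sup>2" by (simp add: power_mult_distrib)
    have "norm (x (x v)) \<le> 4 * norm v"
      using nxv[of "x v"] nxv[of v] by linarith
    then have 1: "norm (t\<^sup>2 *\<^sub>R x (x v)) \<le> t\<^sup>2 * (4 * norm v)"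
      by (simp add: mult_left_mono)
    have 2: "w + t *\<^sub>R x w = v - t\<^sup>2 *\<^sub>R x (x v)"
      by (simp add: w_def blinfun.diff_right blinfun.scaleR_right algebra_simps power2_eq_square)
    have "norm (w + t *\<^sub>R x w) \<le> norm v + t\<^sup>2 * (4 * norm v)"
      unfolding 2 using 1 norm_triangle_ineq4[of v "t\<^sup>2 *\<^sub>R x (x v)"] by linarith
    also have "\<dots> = (1 + 4 * t\<^sup>2) * norm v" by (simp add: algebra_simps)
    finally have "norm (w + t *\<^sub>R x w) \<le> (1 + 4 * t\<^sup>2) * norm v" .
    then have "(norm (w + t *\<^sub>R x w))\<^sup>2 \<le> ((1 + 4 * t\<^sup>2) * norm v)\<^sup>2"
      by (rule power_mono) simp
    then have m1: "(norm (w + t *\<^sub>R x w))\<^sup>2 \<le> (1 + 4 * t\<^sup>2)\<^sup>2 * (norm v)\<^sup>2"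
      by (simp add: power_mult_distrib)
    have r: "0 \<le> \<rho>\<^sup>2 - 1" "\<rho>\<^sup>2 - 1 \<le> 3 * (\<rho> - 1)" "\<rho>\<^sup>2 \<le> 4"
    proof -
      have f: "\<rho>\<^sup>2 - 1 = (\<rho> + 1) * (\<rho> - 1)" by (simp add: algebra_simps power2_eq_square)
      show "0 \<le> \<rho>\<^sup>2 - 1" unfolding f using assms by simp
      show "\<rho>\<^sup>2 - 1 \<le> 3 * (\<rho> - 1)" unfolding f using assms by (intro mult_right_mono) auto
      show "\<rho>\<^sup>2 \<le> 4" using power_mono[OF assms(3), of 2] assms(2) by simp
    qed
    have m2: "(1 - t\<^sup>2) * ((norm (x w))\<^sup>2 + (norm (y w))\<^sup>2 - (norm w)\<^sup>2)
        \<le> (3 * (\<rho> - 1)) * (9 * (norm v)\<^sup>2)"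
    proof -
      have "(1 - t\<^sup>2) * ((norm (x w))\<^sup>2 + (norm (y w))\<^sup>2 - (norm w)\<^sup>2) \<le>
          (1 - t\<^sup>2) * ((\<rho>\<^sup>2 - 1) * (norm w)\<^sup>2)"
        using sw t2 by (intro mult_left_mono) (auto simp: algebra_simps)
      also have "\<dots> \<le> 1 * ((\<rho>\<^sup>2 - 1) * (norm w)\<^sup>2)"
        using r by (intro mult_right_mono) auto
      also have "\<dots> \<le> 1 * ((3 * (\<rho> - 1)) * (9 * (norm v)\<^sup>2))"
        using r nw2 by (intro mult_left_mono mult_mono) auto
      finally show ?thesis by simp
    qed
    have m3: "t\<^sup>2 * (norm (y w))\<^sup>2 \<le> t\<^sup>2 * (36 * (norm v)\<^sup>2)"
    proof (intro mult_left_mono)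
      have "(norm (y w))\<^sup>2 \<le> \<rho>\<^sup>2 * (norm w)\<^sup>2" using sw zero_le_power2[of "norm (x w)"] by linarith
      also have "\<dots> \<le> 4 * (9 * (norm v)\<^sup>2)" using r nw2 by (intro mult_mono) auto
      finally show "(norm (y w))\<^sup>2 \<le> 36 * (norm v)\<^sup>2" by simp
    qed simp
    have "(norm (x w + t *\<^sub>R w))\<^sup>2 + (norm (y w))\<^sup>2 \<le>
        ((1 + 4 * t\<^sup>2)\<^sup>2 + 27 * (\<rho> - 1) + 36 * t\<^sup>2) * (norm v)\<^sup>2"
      using identity m1 m2 m3 by (simp add: algebra_simps)
    also have "\<dots> \<le> K\<^sup>2 * (norm v)\<^sup>2"
    proof (intro mult_right_mono)
      (* K^2 >= (1 + 4 t^2)^2 + 2 p, which dominates the two remaining error terms. *)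
      define p where "p = 18 * t\<^sup>2 + 14 * (\<rho> - 1)"
      have "0 \<le> p" "27 * (\<rho> - 1) + 36 * t\<^sup>2 \<le> 2 * p"
        using assms(2) by (simp_all add: p_def)
      moreover have "K = (1 + 4 * t\<^sup>2) + p" by (simp add: K_def p_def)
      moreover have "p \<le> (1 + 4 * t\<^sup>2) * p"
        using mult_right_mono[of 1 "1 + 4 * t\<^sup>2" p] \<open>0 \<le> p\<close> by simp
      moreover have "0 \<le> p\<^sup>2" by simp
      ultimately show "(1 + 4 * t\<^sup>2)\<^sup>2 + 27 * (\<rho> - 1) + 36 * t\<^sup>2 \<le> K\<^sup>2"
        by (simp only: power2_sum)
    qed simp
    also have "x w + t *\<^sub>R w = (x + t *\<^sub>R (id_blinfun - (x o\<^sub>L x)) - t\<^sup>2 *\<^sub>R x) v"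
      by (simp add: w_def blinfun.diff_right blinfun.scaleR_right blinfun.diff_left
          blinfun.add_left blinfun.scaleR_left algebra_simps power2_eq_square)
    also have "y w = (y - t *\<^sub>R (y o\<^sub>L x)) v"
      by (simp add: w_def blinfun.diff_right blinfun.scaleR_right blinfun.diff_left
          blinfun.scaleR_left)
    finally show "(norm ((x + t *\<^sub>R (id_blinfun - (x o\<^sub>L x)) - t\<^sup>2 *\<^sub>R x) v))\<^sup>2 +
        (norm ((y - t *\<^sub>R (y o\<^sub>L x)) v))\<^sup>2 \<le> K\<^sup>2 * (norm v)\<^sup>2" .
  qed
  then have "norm (col (x + t *\<^sub>R (id_blinfun - (x o\<^sub>L x))) (y - t *\<^sub>R (y o\<^sub>L x))) \<le> K + 2 * t\<^sup>2 + 0"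
    using nx by (rule_tac norm_col_perturb) (auto simp: mult_right_mono mult.commute)
  then show ?thesis by (simp add: K_def)
qed

section \<open>A uniqueness theorem of Cartan type\<close>

text \<open>
  Polynomials in a complex parameter with coefficients in \<open>B\<close>. Holomorphy of
  the iterates below is read off from their coefficients, because the product is just an algebraic
  bilinear operation on the set \<open>B\<close>.
\<close>

inductive polynomial_path :: "'h::chilbert_space op set \<Rightarrow> (complex \<Rightarrow> 'h op) \<Rightarrow> bool" for B where
  monomial: "b \<in> B \<Longrightarrow> polynomial_path B (\<lambda>s. op_scaleC (s ^ k) b)"
| add: "polynomial_path B f \<Longrightarrow> polynomial_path B g \<Longrightarrow> polynomial_path B (\<lambda>s. f s + g s)"

text \<open>
  Rotating \<open>x\<close> by a phase makes the form real, so the real Cauchy-Schwarz inequality applies.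
\<close>

lemma cmod_cinner_le: "cmod (cinner x y) \<le> norm x * norm y"
  for x y :: "'a::chilbert_space"
proof -
  obtain c where c: "cmod c = 1" "c * cinner x y = complex_of_real (cmod (cinner x y))"
  proof (cases "cinner x y = 0")
    case False
    have "cnj (cinner x y) / cmod (cinner x y) * cinner x y = cmod (cinner x y)"
      using False by (simp add: complex_norm_square[symmetric] power2_eq_square mult.commute[of "cnj _"])
    moreover have "cmod (cnj (cinner x y) / cmod (cinner x y)) = 1"
      using False by (simp add: norm_divide)
    ultimately show ?thesis using that by blast
  qed (use that[of 1] in simp)
  have "cmod (cinner x y) = Re (cinner (c *\<^sub>C x) y)"
    using c by (simp add: cinner_scaleC_left)
  also have "\<dots> \<le> norm (c *\<^sub>C x) * norm y"
    unfolding Re_cinner by (rule norm_cauchy_schwarz)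
  finally show ?thesis using c by (simp add: norm_scaleC)
qed

locale complex_bilinear_product =
  fixes B :: "'h::chilbert_space op set" and m :: "'h op \<Rightarrow> 'h op \<Rightarrow> 'h op"
  assumes add_mem: "a \<in> B \<Longrightarrow> b \<in> B \<Longrightarrow> a + b \<in> B"
    and scaleC_mem: "a \<in> B \<Longrightarrow> op_scaleC c a \<in> B"
    and product_mem: "a \<in> B \<Longrightarrow> b \<in> B \<Longrightarrow> m a b \<in> B"
    and product_add_left: "a \<in> B \<Longrightarrow> b \<in> B \<Longrightarrow> d \<in> B \<Longrightarrow> m (a + b) d = m a d + m b d"
    and product_add_right: "a \<in> B \<Longrightarrow> b \<in> B \<Longrightarrow> d \<in> B \<Longrightarrow> m d (a + b) = m d a + m d b"
    and product_scaleC_left: "a \<in> B \<Longrightarrow> b \<in> B \<Longrightarrow> m (op_scaleC c a) b = op_scaleC c (m a b)"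
    and product_scaleC_right: "a \<in> B \<Longrightarrow> b \<in> B \<Longrightarrow> m a (op_scaleC c b) = op_scaleC c (m a b)"
begin

lemma path_mem: "polynomial_path B f \<Longrightarrow> f s \<in> B"
  by (induction rule: polynomial_path.induct) (auto intro: add_mem scaleC_mem)

lemma path_product:
  assumes "polynomial_path B f" "polynomial_path B g"
  shows "polynomial_path B (\<lambda>s. m (f s) (g s))"
  using assms
proof (induction rule: polynomial_path.induct)
  case (monomial b k)
  from monomial(2,1) show ?case
  proof (induction rule: polynomial_path.induct)
    case (monomial b' k')
    have "m (op_scaleC (s ^ k) b) (op_scaleC (s ^ k') b') = op_scaleC (s ^ (k + k')) (m b b')" for s
      using monomial by (simp add: product_scaleC_left product_scaleC_right scaleC_mem
          op_scaleC_op_scaleC power_add mult.commute)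
    then show ?case
      using monomial polynomial_path.monomial[of "m b b'" B "k + k'"] by (simp add: product_mem)
  next
    case (add f g)
    then show ?case
      using polynomial_path.add[OF add(3,4)]
      by (simp add: product_add_right path_mem[OF add(1)] path_mem[OF add(2)] scaleC_mem)
  qed
next
  case (add f1 f2)
  then show ?case
    using polynomial_path.add[OF add(3,4)]
    by (simp add: product_add_left path_mem[OF add(1)] path_mem[OF add(2)] path_mem[OF assms(2)])
qed

lemma path_times_parameter:
  assumes "polynomial_path B f"
  shows "polynomial_path B (\<lambda>s. op_scaleC s (f s))"
  using assms
proof (induction rule: polynomial_path.induct)
  case (monomial b k)
  then show ?case
    using polynomial_path.monomial[of b B "Suc k"] by (simp add: op_scaleC_op_scaleC)
next
  case (add f g)
  then show ?case
    using polynomial_path.add[OF add(3,4)] by (simp add: op_scaleC_add)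
qed

lemma path_const: "b \<in> B \<Longrightarrow> polynomial_path B (\<lambda>s. b)"
  using polynomial_path.monomial[of b B 0] by (simp add: op_scaleC_one)

lemma path_matrix_coefficient_holomorphic:
  "polynomial_path B f \<Longrightarrow> (\<lambda>s. cinner (blinfun_apply (f s) u) v) holomorphic_on S"
proof (induction rule: polynomial_path.induct)
  case (monomial b k)
  then show ?case
    by (simp add: op_scaleC.rep_eq cinner_scaleC_left) (intro holomorphic_intros)
next
  case (add f g)
  then show ?case
    by (simp add: blinfun.add_left cinner_add_left) (intro holomorphic_intros)
qed

text \<open>
  The \<open>n\<close>-th iterate of \<open>(a, b) \<mapsto> (a + s m(a, a), b + s m(b, a))\<close>, as a function of \<open>s\<close>.
\<close>

primrec iterate :: "'h op \<Rightarrow> 'h op \<Rightarrow> nat \<Rightarrow> complex \<Rightarrow> 'h op \<times> 'h op" where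
  "iterate x y 0 s = (x, y)"
| "iterate x y (Suc n) s = (let (a, b) = iterate x y n s in
     (a + op_scaleC s (m a a), b + op_scaleC s (m b a)))"

lemma iterate_path:
  assumes "x \<in> B" "y \<in> B"
  shows "polynomial_path B (\<lambda>s. fst (iterate x y n s)) \<and>
    polynomial_path B (\<lambda>s. snd (iterate x y n s))"
proof (induction n)
  case 0
  then show ?case using assms by (simp add: path_const)
next
  case (Suc n)
  then show ?case
    by (simp add: Let_def case_prod_unfold polynomial_path.add path_times_parameter path_product)
qed

lemma iterate_mem:
  assumes "x \<in> B" "y \<in> B"
  shows "fst (iterate x y n s) \<in> B" "snd (iterate x y n s) \<in> B"
  using iterate_path[OF assms, of n] path_mem[of "\<lambda>s. fst (iterate x y n s)" s]
    path_mem[of "\<lambda>s. snd (iterate x y n s)" s] by simp_all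

lemma iterate_at_0: "iterate x y n 0 = (x, y)"
proof -
  have "op_scaleC 0 f = 0" for f :: "'h op"
    using op_scaleC_of_real[of 0 f] by simp
  then show ?thesis by (induction n) simp_all
qed

lemma iterate_derivative:
  assumes "x \<in> B" "y \<in> B"
  shows "((\<lambda>s. cinner (blinfun_apply (snd (iterate x y n s)) u) v) has_field_derivative
    of_nat n * cinner (blinfun_apply (m y x) u) v) (at 0)"
proof (induction n)
  case 0
  then show ?case by simp
next
  case (Suc n)
  let ?p = "\<lambda>s. m (snd (iterate x y n s)) (fst (iterate x y n s))"
  let ?g = "\<lambda>s. cinner (blinfun_apply (?p s) u) v"
  have "?g holomorphic_on UNIV"
    using iterate_path[OF assms] by (intro path_matrix_coefficient_holomorphic path_product) auto
  then have "(?g has_field_derivative deriv ?g 0) (at 0)"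
    by (intro holomorphic_derivI[of _ UNIV]) auto
  from DERIV_mult[OF DERIV_ident this]
  have "((\<lambda>s. s * ?g s) has_field_derivative cinner (blinfun_apply (m y x) u) v) (at 0)"
    by (simp add: iterate_at_0)
  from DERIV_add[OF Suc this] show ?case
    by (simp add: Let_def case_prod_unfold blinfun.add_left cinner_add_left op_scaleC.rep_eq
        cinner_scaleC_left algebra_simps)
qed

context
  fixes C :: real
  assumes C: "0 \<le> C"
    and step: "\<And>x y s. x \<in> B \<Longrightarrow> y \<in> B \<Longrightarrow> norm (col x y) \<le> 1 \<Longrightarrow> cmod s \<le> 1/8 \<Longrightarrow>
      norm (col (x + op_scaleC s (m x x)) (y + op_scaleC s (m y x))) \<le> 1 + C * (cmod s)\<^sup>2"
begin

text \<open>
  By homogeneity the assumption on contractive columns extends to columns of norm at most \<open>2\<close>; this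
  is needed since the iterates may leave the unit ball.
\<close>

lemma step_scaled:
  assumes "x \<in> B" "y \<in> B" "norm (col x y) \<le> \<rho>" "0 < \<rho>" "\<rho> \<le> 2" "cmod s \<le> 1/16"
  shows "norm (col (x + op_scaleC s (m x x)) (y + op_scaleC s (m y x))) \<le>
    \<rho> * (1 + 4 * C * (cmod s)\<^sup>2)"
proof -
  define r where "r = complex_of_real \<rho>"
  define x' y' where "x' = op_scaleC (1 / r) x" and "y' = op_scaleC (1 / r) y"
  have r: "r \<noteq> 0" "cmod r = \<rho>" using assms(4) by (simp_all add: r_def)
  have mem: "x' \<in> B" "y' \<in> B" using assms by (simp_all add: x'_def y'_def scaleC_mem)
  have xy: "x = op_scaleC r x'" "y = op_scaleC r y'"
    using r by (simp_all add: x'_def y'_def op_scaleC_op_scaleC op_scaleC_one)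
  have "norm (col x' y') \<le> 1"
    using assms(3,4) r by (simp add: x'_def y'_def norm_col_op_scaleC norm_divide)
  moreover have small: "cmod (r * s) \<le> 2 * cmod s"
    using assms(5) r(2) by (simp add: norm_mult mult_right_mono)
  moreover have "cmod (r * s) \<le> 1/8"
    using small assms(6) by simp
  ultimately have *: "norm (col (x' + op_scaleC (r * s) (m x' x')) (y' + op_scaleC (r * s) (m y' x')))
      \<le> 1 + C * (cmod (r * s))\<^sup>2"
    using step mem by blast
  also have "\<dots> \<le> 1 + C * (2 * cmod s)\<^sup>2"
    using C small by (intro add_left_mono mult_left_mono power_mono) auto
  finally have "cmod r * norm (col (x' + op_scaleC (r * s) (m x' x')) (y' + op_scaleC (r * s) (m y' x')))
      \<le> \<rho> * (1 + 4 * C * (cmod s)\<^sup>2)"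
    using assms(4) r(2) by (simp add: power_mult_distrib)
  moreover have "op_scaleC s (m a b) = op_scaleC r (op_scaleC (r * s) (m a' b'))"
    if "a = op_scaleC r a'" "b = op_scaleC r b'" "a' \<in> B" "b' \<in> B" for a b a' b'
    using that by (simp add: product_scaleC_left product_scaleC_right scaleC_mem
        op_scaleC_op_scaleC ac_simps)
  from this[OF xy(1) xy(1) mem(1) mem(1)] this[OF xy(2) xy(1) mem(2) mem(1)]
  have "col (x + op_scaleC s (m x x)) (y + op_scaleC s (m y x)) =
      col (op_scaleC r (x' + op_scaleC (r * s) (m x' x'))) (op_scaleC r (y' + op_scaleC (r * s) (m y' x')))"
    by (simp only: op_scaleC_add xy(1)[symmetric] xy(2)[symmetric])
  ultimately show ?thesis by (simp only: norm_col_op_scaleC)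
qed

lemma iterate_bound:
  assumes "x \<in> B" "y \<in> B" "norm (col x y) \<le> 1" "cmod s \<le> 1/16"
    and "(1 + 4 * C * (cmod s)\<^sup>2) ^ n \<le> 2"
  shows "norm (col (fst (iterate x y n s)) (snd (iterate x y n s))) \<le> (1 + 4 * C * (cmod s)\<^sup>2) ^ n"
  using assms(5)
proof (induction n)
  case 0
  then show ?case using assms by simp
next
  case (Suc n)
  let ?q = "1 + 4 * C * (cmod s)\<^sup>2"
  have q: "1 \<le> ?q" using C by simp
  have "?q ^ n \<le> ?q ^ Suc n" by (rule power_increasing) (use q in auto)
  then have le2: "?q ^ n \<le> 2" using Suc.prems by linarith
  have "norm (col (fst (iterate x y (Suc n) s)) (snd (iterate x y (Suc n) s))) \<le> ?q ^ n * ?q"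
    using step_scaled[OF iterate_mem[OF assms(1,2)] Suc.IH[OF le2] _ le2 assms(4)]
      zero_less_power[of ?q n] q
    by (simp add: Let_def case_prod_unfold)
  then show ?case by (simp add: mult.commute)
qed

text \<open>
  Iterate \<open>k\<^sup>2\<close> times with steps \<open>s\<close> of modulus \<open>1/(c k)\<close>. The norms grow at most by the factor
  \<open>(1 + O(1/k\<^sup>2))^(k\<^sup>2)\<close>, which is bounded by \<open>2\<close> if \<open>c\<close> is large. On the other hand the derivative at \<open>s = 0\<close>
  of the second entry is \<open>k\<^sup>2 m(y, x)\<close>. Cauchy's estimate on the circle of radius \<open>1/(c k)\<close> bounds
  it by \<open>O(k)\<close>, so \<open>m(y, x) = O(1/k)\<close>.
\<close>

lemma product_eq_0_of_norm_col_le_1: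
  assumes "x \<in> B" "y \<in> B" "norm (col x y) \<le> 1"
  shows "m y x = 0"
proof (rule blinfun_eqI)
  fix u
  define v where "v = blinfun_apply (m y x) u"
  (* Large enough for steps of modulus at most 1/16 and for 8 C <= c^2, which keeps the growth
     below exp (1/2) <= 2. *)
  define c where "c = 16 + 8 * C"
  have c: "16 \<le> c" "8 * C \<le> c\<^sup>2"
  proof -
    show "16 \<le> c" using C by (simp add: c_def)
    then have "1 * c \<le> c * c" by (intro mult_right_mono) auto
    then show "8 * C \<le> c\<^sup>2" unfolding power2_eq_square using C c_def by linarith
  qed
  have bound: "cmod (cinner v v) * real k \<le> 2 * norm u * norm v * c" if k: "1 \<le> k" for k :: nat
  proof -
    define r where "r = 1 / (c * real k)"
    have r: "0 < r" "r \<le> 1/16"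
    proof -
      show "0 < r" using c k by (simp add: r_def)
      have "16 * 1 \<le> c * real k" using c k by (intro mult_mono) auto
      then show "r \<le> 1/16" by (simp add: r_def field_simps)
    qed
    have ck: "c \<noteq> 0" "real k \<noteq> 0" using c k by auto
    have "4 * C * r\<^sup>2 * real (k\<^sup>2) = 4 * C / c\<^sup>2"
      using ck by (simp add: r_def power_mult_distrib power_divide)
    also have "\<dots> \<le> 1/2"
      using c by (simp add: divide_simps)
    finally have "exp (4 * C * r\<^sup>2 * real (k\<^sup>2)) \<le> exp (1/2)"
      by (simp only: exp_le_cancel_iff)
    then have "exp (4 * C * r\<^sup>2 * real (k\<^sup>2)) \<le> 2"
      using exp_half_le2 by (rule order_trans)
    moreover have "(1 + 4 * C * r\<^sup>2) ^ (k\<^sup>2) \<le> exp (4 * C * r\<^sup>2) ^ (k\<^sup>2)"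
      using C by (intro power_mono exp_ge_add_one_self) simp
    ultimately have two: "(1 + 4 * C * r\<^sup>2) ^ (k\<^sup>2) \<le> 2"
      by (simp add: exp_of_nat2_mult[symmetric])
    let ?f = "\<lambda>s. cinner (blinfun_apply (snd (iterate x y (k\<^sup>2) s)) u) v"
    have hol: "?f holomorphic_on UNIV"
      using iterate_path[OF assms(1,2)] by (intro path_matrix_coefficient_holomorphic) auto
    have "norm ((deriv ^^ 1) ?f 0) \<le> fact 1 * (2 * norm u * norm v) / r ^ 1"
    proof (rule Cauchy_inequality)
      show "?f holomorphic_on ball 0 r" "continuous_on (cball 0 r) ?f"
        using hol by (auto intro: holomorphic_on_subset holomorphic_on_imp_continuous_on)
      fix s :: complex assume "norm (0 - s) = r"
      then have s: "cmod s = r" by simp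
      have "norm (col (fst (iterate x y (k\<^sup>2) s)) (snd (iterate x y (k\<^sup>2) s))) \<le> 2"
        using iterate_bound[OF assms, of s "k\<^sup>2"] two r s by auto
      then have "norm (snd (iterate x y (k\<^sup>2) s)) \<le> 2"
        using norm_le_norm_col(2) order_trans by blast
      then have "norm (snd (iterate x y (k\<^sup>2) s) u) * norm v \<le> 2 * norm u * norm v"
        by (intro mult_right_mono norm_apply_le_norm) simp_all
      then show "norm (?f s) \<le> 2 * norm u * norm v"
        using cmod_cinner_le order_trans by blast
    qed (use r in auto)
    moreover have "deriv ?f 0 = of_nat (k\<^sup>2) * cinner v v"
      unfolding v_def by (rule DERIV_imp_deriv[OF iterate_derivative[OF assms(1,2)]])
    ultimately have "real (k\<^sup>2) * cmod (cinner v v) \<le> 2 * norm u * norm v * c * real k"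
      by (simp add: r_def norm_mult norm_power ac_simps)
    then show ?thesis
      using ck by (simp add: power2_eq_square ac_simps)
  qed
  (* The bound holds for every k, so its left-hand side vanishes by the Archimedean property. *)
  have "cmod (cinner v v) = 0"
  proof (rule ccontr)
    assume "cmod (cinner v v) \<noteq> 0"
    then have pos: "0 < cmod (cinner v v)" by simp
    obtain k where k: "(2 * norm u * norm v * c) / cmod (cinner v v) < real k"
      using reals_Archimedean2 by blast
    then have k1: "2 * norm u * norm v * c < real k * cmod (cinner v v)"
      using pos by (simp add: divide_simps)
    have "1 \<le> k"
    proof (rule ccontr)
      assume "\<not> 1 \<le> k"
      then have "k = 0" by simp
      then show False using k1 c by (simp add: mult_less_0_iff)
    qed
    from bound[OF this] k1 show False by (simp add: mult.commute)
  qed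
  then show "m y x u = blinfun_apply 0 u"
    by (simp add: cinner_self flip: v_def)
qed

lemma product_eq_0:
  assumes "x \<in> B" "y \<in> B"
  shows "m y x = 0"
proof -
  define r where "r = complex_of_real (1 / (1 + norm (col x y)))"
  have pos: "0 < 1 + norm (col x y)" by (simp add: add_pos_nonneg)
  have "cmod r = \<bar>1 / (1 + norm (col x y))\<bar>"
    unfolding r_def by (rule norm_of_real)
  then have r: "cmod r = 1 / (1 + norm (col x y))"
    using pos by simp
  then have r0: "r \<noteq> 0" using pos by auto
  have "norm (col (op_scaleC r x) (op_scaleC r y)) \<le> 1"
    using pos by (simp add: norm_col_op_scaleC r)
  then have "m (op_scaleC r y) (op_scaleC r x) = 0"
    by (intro product_eq_0_of_norm_col_le_1 scaleC_mem assms)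
  then have "op_scaleC (r * r) (m y x) = 0"
    using assms by (simp add: product_scaleC_left product_scaleC_right scaleC_mem op_scaleC_op_scaleC)
  then have "(r * r) *\<^sub>C blinfun_apply (m y x) u = 0" for u
    by (metis op_scaleC.rep_eq blinfun.zero_left)
  then have "cmod (r * r) * norm (blinfun_apply (m y x) u) = 0" for u
    by (metis norm_scaleC norm_zero)
  then show ?thesis
    using r0 by (intro blinfun_eqI) simp
qed

end

end

section \<open>Norms of operator matrices\<close>

lemma vec_norm_nonneg [simp]: "0 \<le> vec_norm n v"
  by (simp add: vec_norm_def L2_set_nonneg)

lemma vec_norm_sq: "(vec_norm n v)\<^sup>2 = (\<Sum>i<n. (norm (v i))\<^sup>2)"
  by (simp add: vec_norm_def L2_set_def sum_nonneg)

lemma vec_norm_mat_apply_le_sum: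
  "vec_norm n (mat_apply n a v) \<le> (\<Sum>i<n. \<Sum>j<n. norm (a i j)) * vec_norm n v"
proof -
  have "vec_norm n (mat_apply n a v) \<le> (\<Sum>i<n. norm (mat_apply n a v i))"
    unfolding vec_norm_def by (rule L2_set_le_sum) simp
  also have "\<dots> \<le> (\<Sum>i<n. \<Sum>j<n. norm (a i j) * vec_norm n v)"
  proof (intro sum_mono)
    fix i
    have "norm (mat_apply n a v i) \<le> (\<Sum>j<n. norm (a i j (v j)))"
      unfolding mat_apply_def by (rule norm_sum)
    also have "\<dots> \<le> (\<Sum>j<n. norm (a i j) * vec_norm n v)"
    proof (intro sum_mono)
      fix j assume "j \<in> {..<n}"
      then have "norm (v j) \<le> vec_norm n v"
        unfolding vec_norm_def by (intro member_le_L2_set) auto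
      then show "norm (a i j (v j)) \<le> norm (a i j) * vec_norm n v"
        using norm_blinfun[of "a i j" "v j"] mult_left_mono[of "norm (v j)" "vec_norm n v" "norm (a i j)"]
        by simp
    qed
    finally show "norm (mat_apply n a v i) \<le> (\<Sum>j<n. norm (a i j) * vec_norm n v)" .
  qed
  finally show ?thesis by (simp add: sum_distrib_right)
qed

lemma vec_norm_mat_apply_le_mat_norm:
  assumes "vec_norm n v \<le> 1"
  shows "vec_norm n (mat_apply n a v) \<le> mat_norm n a"
proof -
  have "bdd_above ((\<lambda>u. vec_norm n (mat_apply n a u)) ` {u. vec_norm n u \<le> 1})"
  proof (rule bdd_aboveI2)
    fix u :: "nat \<Rightarrow> 'a" assume u: "u \<in> {u. vec_norm n u \<le> 1}"
    have "(\<Sum>i<n. \<Sum>j<n. norm (a i j)) * vec_norm n u \<le> (\<Sum>i<n. \<Sum>j<n. norm (a i j)) * 1"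
      using u by (intro mult_left_mono sum_nonneg) auto
    then show "vec_norm n (mat_apply n a u) \<le> (\<Sum>i<n. \<Sum>j<n. norm (a i j))"
      using vec_norm_mat_apply_le_sum[of n a u] by simp
  qed
  then show ?thesis
    unfolding mat_norm_def using assms by (intro cSUP_upper) auto
qed

lemma vec_norm_scaleR: "vec_norm n (\<lambda>i. r *\<^sub>R v i) = \<bar>r\<bar> * vec_norm n v"
  by (simp add: vec_norm_def L2_set_right_distrib)

lemma vec_norm_mat_apply_le: "vec_norm n (mat_apply n a v) \<le> mat_norm n a * vec_norm n v"
proof (cases "vec_norm n v = 0")
  case True
  then show ?thesis using vec_norm_mat_apply_le_sum[of n a v] by simp
next
  case False
  define r where "r = vec_norm n v"
  have r: "0 < r" using False vec_norm_nonneg[of n v] unfolding r_def by linarith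
  let ?u = "\<lambda>i. (1 / r) *\<^sub>R v i"
  have "vec_norm n ?u \<le> 1"
    using r by (simp add: vec_norm_scaleR r_def[symmetric])
  then have "vec_norm n (mat_apply n a ?u) \<le> mat_norm n a"
    by (rule vec_norm_mat_apply_le_mat_norm)
  moreover have "mat_apply n a ?u = (\<lambda>i. (1 / r) *\<^sub>R mat_apply n a v i)"
    by (simp add: mat_apply_def blinfun.scaleR_right scaleR_sum_right)
  ultimately show ?thesis
    using r by (simp add: vec_norm_scaleR r_def[symmetric] divide_simps)
qed

lemma mat_norm_le:
  assumes "\<And>v. vec_norm n (mat_apply n a v) \<le> K * vec_norm n v" "0 \<le> K"
  shows "mat_norm n a \<le> K"
  unfolding mat_norm_def
proof (rule cSUP_least)
  have "vec_norm n (\<lambda>i. 0 :: 'a) \<le> 1" by (simp add: vec_norm_def L2_set_def)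
  then show "{v :: nat \<Rightarrow> 'a. vec_norm n v \<le> 1} \<noteq> {}" by blast
  fix v :: "nat \<Rightarrow> 'a" assume "v \<in> {v. vec_norm n v \<le> 1}"
  then have "K * vec_norm n v \<le> K * 1" using assms(2) by (intro mult_left_mono) auto
  then show "vec_norm n (mat_apply n a v) \<le> K" using assms(1)[of v] by simp
qed

text \<open>
  Columns of length two are \<open>2 \<times> 2\<close> matrices with vanishing second column, so a complete isometry
  preserves their norms.
\<close>

lemma mat_norm_column:
  fixes a b :: "'h::chilbert_space op"
  defines "c \<equiv> \<lambda>i j. if j = 0 then if i = 0 then a else b else (0 :: 'h op)"
  shows "mat_norm 2 c = norm (col a b)"
proof (rule antisym)
  have two: "vec_norm 2 v = sqrt ((norm (v 0))\<^sup>2 + (norm (v 1))\<^sup>2)" for v :: "nat \<Rightarrow> 'h"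
    by (simp add: vec_norm_def L2_set_def numeral_2_eq_2)
  have app: "mat_apply 2 c v 0 = a (v 0)" "mat_apply 2 c v 1 = b (v 0)" for v
    by (simp_all add: mat_apply_def c_def numeral_2_eq_2)
  have sq: "vec_norm 2 (mat_apply 2 c v) = norm (col a b (v 0))" for v
    unfolding two app by (simp flip: norm_col_apply_sq)
  show "mat_norm 2 c \<le> norm (col a b)"
  proof (rule mat_norm_le)
    fix v :: "nat \<Rightarrow> 'h"
    have "norm (v 0) \<le> vec_norm 2 v"
      unfolding two by (rule real_le_rsqrt) simp
    then show "vec_norm 2 (mat_apply 2 c v) \<le> norm (col a b) * vec_norm 2 v"
      unfolding sq using norm_blinfun[of "col a b" "v 0"] mult_left_mono norm_ge_zero order_trans
      by blast
  qed simp
  show "norm (col a b) \<le> mat_norm 2 c"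
  proof (rule norm_blinfun_bound)
    show "norm (col a b u) \<le> mat_norm 2 c * norm u" for u
      using vec_norm_mat_apply_le[of 2 c "\<lambda>i. if i = 0 then u else 0"] unfolding sq by (simp add: two)
    have "vec_norm 2 (mat_apply 2 c (\<lambda>i. 0)) \<le> mat_norm 2 c"
      by (rule vec_norm_mat_apply_le_mat_norm) (simp add: two)
    then show "0 \<le> mat_norm 2 c"
      using vec_norm_nonneg order_trans by blast
  qed
qed

lemma sum_inner_le_vec_norm:
  fixes u v :: "nat \<Rightarrow> 'a::chilbert_space"
  shows "(\<Sum>i<n. inner (u i) (v i)) \<le> vec_norm n u * vec_norm n v"
proof -
  have "(\<Sum>i<n. inner (u i) (v i)) \<le> (\<Sum>i<n. \<bar>norm (u i)\<bar> * \<bar>norm (v i)\<bar>)"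
    by (intro sum_mono) (simp add: norm_cauchy_schwarz)
  also have "\<dots> \<le> vec_norm n u * vec_norm n v"
    unfolding vec_norm_def by (rule L2_set_mult_ineq)
  finally show ?thesis .
qed

section \<open>Real positive complete isometries are multiplicative\<close>

locale complete_isometry = A: approx_unital_algebra A + B: approx_unital_algebra B
  for A :: "'h::chilbert_space op set" and B :: "'k::chilbert_space op set" +
  fixes T :: "'h op \<Rightarrow> 'k op"
  assumes isometric_surjection: "completely_isometric_surjection A B T"
begin

lemma linear: "linear_map A B T"
  and T_mem: "a \<in> A \<Longrightarrow> T a \<in> B"
  and T_add: "a \<in> A \<Longrightarrow> b \<in> A \<Longrightarrow> T (a + b) = T a + T b"
  and T_scaleC: "a \<in> A \<Longrightarrow> T (op_scaleC c a) = op_scaleC c (T a)"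
  and T_surj: "T ` A = B"
  and mat_norm_T: "1 \<le> n \<Longrightarrow> x \<in> mat_over n A \<Longrightarrow> mat_norm n (amplification T x) = mat_norm n x"
  using isometric_surjection
  unfolding completely_isometric_surjection_def linear_map_def by auto

lemma T_scaleR: "a \<in> A \<Longrightarrow> T (r *\<^sub>R a) = r *\<^sub>R T a"
  using T_scaleC[of a "complex_of_real r"] by (simp add: op_scaleC_of_real)

lemma T_diff: "a \<in> A \<Longrightarrow> b \<in> A \<Longrightarrow> T (a - b) = T a - T b"
  using T_add[of a "(-1) *\<^sub>R b"] T_scaleR[of b "-1"] A.scaleR_mem[of b "-1"] by simp

lemma zero_mem: "0 \<in> A"
  using A.operator_algebra by (simp add: operator_algebra_def)

lemma T_zero: "T 0 = 0"
  using T_diff[OF zero_mem zero_mem] by simp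

lemma norm_col_T:
  assumes "a \<in> A" "b \<in> A"
  shows "norm (col (T a) (T b)) = norm (col a b)"
proof -
  let ?c = "\<lambda>a b i j. if j = (0::nat) then if i = (0::nat) then a else b else 0"
  have "?c a b \<in> mat_over 2 A"
    using assms zero_mem by (auto simp: mat_over_def)
  from mat_norm_T[OF _ this]
  have "mat_norm 2 (amplification T (?c a b)) = norm (col a b)"
    by (simp add: mat_norm_column)
  moreover have "amplification T (?c a b) = ?c (T a) (T b)"
    by (auto simp: amplification_def T_zero fun_eq_iff)
  ultimately show ?thesis by (simp add: mat_norm_column)
qed

lemma norm_T: "a \<in> A \<Longrightarrow> norm (T a) = norm a"
  using norm_col_T[OF _ zero_mem] by (simp add: T_zero)

definition T_inv :: "'k op \<Rightarrow> 'h op" where "T_inv = inv_into A T"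

lemma T_inv_mem: "b \<in> B \<Longrightarrow> T_inv b \<in> A"
  and T_T_inv: "b \<in> B \<Longrightarrow> T (T_inv b) = b"
  unfolding T_inv_def using T_surj by (auto intro: inv_into_into f_inv_into_f)

lemma T_inj: "a \<in> A \<Longrightarrow> b \<in> A \<Longrightarrow> T a = T b \<Longrightarrow> a = b"
  using norm_T[of "a - b"] T_diff[of a b] A.diff_mem[of a b] by simp

lemma T_inv_T: "a \<in> A \<Longrightarrow> T_inv (T a) = a"
  by (intro T_inj) (simp_all add: T_inv_mem T_T_inv T_mem)

lemma T_inv_add: "a \<in> B \<Longrightarrow> b \<in> B \<Longrightarrow> T_inv (a + b) = T_inv a + T_inv b"
  by (intro T_inj) (simp_all add: T_inv_mem T_T_inv T_add A.add_mem B.add_mem)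

lemma T_inv_scaleC: "b \<in> B \<Longrightarrow> T_inv (op_scaleC c b) = op_scaleC c (T_inv b)"
  by (intro T_inj) (simp_all add: T_inv_mem T_T_inv T_scaleC A.scaleC_mem B.scaleC_mem)

text \<open>
  Replace \<open>x\<close> by an accretive element at distance at most \<open>2 \<epsilon>\<close> and use that \<open>T\<close> is isometric.
\<close>

lemma almost_accretive:
  assumes "real_positive A B T" "x \<in> A" "0 < \<epsilon>"
    and "\<And>v. - \<epsilon> * (norm v)\<^sup>2 \<le> inner (blinfun_apply x v) v"
  shows "- (2 * \<epsilon>) * (norm v)\<^sup>2 \<le> inner (blinfun_apply (T x) v) v"
proof -
  obtain z where z: "z \<in> A" "\<And>v. 0 \<le> inner (blinfun_apply z v) v" "norm (z - x) \<le> 2 * \<epsilon>"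
    using A.accretive_approximation[OF assms(2-4)] by blast
  have "T z \<in> real_pos_elems B"
    using assms(1) z by (auto simp: real_positive_def real_pos_elems_iff[OF A.subset_BH])
  then have "0 \<le> inner (T z v) v"
    by (simp add: real_pos_elems_iff[OF B.subset_BH])
  moreover have "inner (T (z - x) v) v \<le> (2 * \<epsilon> * norm v) * norm v"
  proof -
    have "inner (T (z - x) v) v \<le> norm (T (z - x) v) * norm v"
      by (rule norm_cauchy_schwarz)
    also have "\<dots> \<le> (2 * \<epsilon> * norm v) * norm v"
      using z assms(2) by (intro mult_right_mono norm_apply_le_norm) (simp_all add: norm_T A.diff_mem)
    finally show ?thesis .
  qed
  moreover have "inner (T x v) v = inner (T z v) v - inner (T (z - x) v) v"
    using z assms(2) by (simp add: T_diff blinfun.diff_left inner_diff_left)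
  ultimately show ?thesis by (simp add: power2_eq_square)
qed

text \<open>
  Let \<open>f\<close> be a contraction in \<open>B\<close> with \<open>b f \<approx> b\<close>, and \<open>a = T\<^sup>-\<^sup>1 f\<close>. With \<open>y\<close> a compressing unit for \<open>a\<close>
  and \<open>e = y\<^sup>2\<close>, the form of \<open>e - a\<close> is almost \<open>\<parallel>y v\<parallel>\<^sup>2 - Re \<langle>a y v, y v\<rangle>\<close>, which is nonnegative because
  \<open>\<parallel>a\<parallel> \<le> 1\<close>. Hence \<open>Re T e \<ge> Re f\<close> up to a small error. At vectors \<open>v = b\<^sup>* u\<close> the form of \<open>f\<close> is almost
  \<open>\<parallel>v\<parallel>\<^sup>2\<close>, so the contraction \<open>(T e)\<^sup>*\<close> almost fixes \<open>v\<close>; that is, \<open>b T e \<approx> b\<close>.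
\<close>

lemma unit_with_unit_image:
  assumes pos: "real_positive A B T" and fin: "finite E" "E \<subseteq> A" and b: "b \<in> B" and "0 < \<epsilon>"
  shows "\<exists>e\<in>A. norm e \<le> 1 \<and> (\<forall>a\<in>E. norm ((e o\<^sub>L a) - a) \<le> \<epsilon>) \<and> norm ((b o\<^sub>L T e) - b) \<le> \<epsilon>"
proof -
  define d where "d = 2 * norm b + 8 * (norm b)\<^sup>2 + 1"
  have d: "0 < d" unfolding d_def by (intro add_nonneg_pos) auto
  (* The error is c (2 |b| + 8 |b|^2) = c (d - 1), and has to stay below the square of epsilon. *)
  define c where "c = min \<epsilon> (\<epsilon>\<^sup>2 / d)"
  have c: "0 < c" "c \<le> \<epsilon>" "c * d \<le> \<epsilon>\<^sup>2"
  proof -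
    show "0 < c" "c \<le> \<epsilon>" using d \<open>0 < \<epsilon>\<close> by (simp_all add: c_def)
    have "c \<le> \<epsilon>\<^sup>2 / d" by (simp add: c_def)
    then show "c * d \<le> \<epsilon>\<^sup>2" using d by (simp add: pos_le_divide_eq)
  qed
  obtain f where f: "f \<in> B" "norm f \<le> 1" "norm ((b o\<^sub>L f) - b) \<le> c"
    using B.contractive_unit[of "{b}" c] b c by auto
  define a where "a = T_inv f"
  have a: "a \<in> A" "T a = f" "norm a \<le> 1"
    using f T_inv_mem[OF f(1)] T_T_inv[OF f(1)] norm_T[of a] by (auto simp: a_def)
  obtain y where y: "y \<in> A" "norm y \<le> 1"
      "\<And>s. s \<in> E \<Longrightarrow> norm ((y o\<^sub>L y o\<^sub>L s) - s) \<le> c"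
      "\<And>v. \<bar>inner (a v) v - inner (a (y v)) (y v)\<bar> \<le> c * (norm v)\<^sup>2"
      "\<And>v. \<bar>inner ((y o\<^sub>L y) v) v - (norm (y v))\<^sup>2\<bar> \<le> c * (norm v)\<^sup>2"
    using A.compressing_unit[OF fin a(1) c(1)] by blast
  define e where "e = y o\<^sub>L y"
  have e: "e \<in> A" unfolding e_def by (intro A.compose_mem y)
  have e1: "norm e \<le> 1"
    unfolding e_def using norm_blinfun_compose[of y y] mult_mono[OF y(2) y(2)] by simp
  have "- (2 * c) * (norm v)\<^sup>2 \<le> inner ((e - a) v) v" for v
  proof -
    have "inner (a (y v)) (y v) \<le> norm (a (y v)) * norm (y v)"
      by (rule norm_cauchy_schwarz)
    also have "\<dots> \<le> (1 * norm (y v)) * norm (y v)"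
      by (intro mult_right_mono norm_apply_le_norm a) simp
    finally have "inner (a (y v)) (y v) \<le> (norm (y v))\<^sup>2" by (simp add: power2_eq_square)
    moreover have "inner ((e - a) v) v = inner (e v) v - inner (a v) v"
      by (simp add: blinfun.diff_left inner_diff_left)
    ultimately show ?thesis
      using y(4)[of v] y(5)[of v] unfolding e_def[symmetric] by linarith
  qed
  then have low: "- (2 * (2 * c)) * (norm v)\<^sup>2 \<le> inner (T (e - a) v) v" for v
    by (intro almost_accretive[OF pos]) (use c a e in \<open>auto intro: A.diff_mem\<close>)
  let ?g = "T e"
  have g: "norm ?g \<le> 1" using e e1 by (simp add: norm_T)
  have "(norm ((adj ?g o\<^sub>L adj b) - adj b))\<^sup>2 \<le> \<epsilon>\<^sup>2"
  proof (rule norm_sq_le_of_apply)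
    fix u
    define v where "v = blinfun_apply (adj b) u"
    have nv: "norm v \<le> norm b * norm u"
      unfolding v_def by (rule norm_adj_apply_le)
    have nv2: "(norm v)\<^sup>2 \<le> (norm b)\<^sup>2 * (norm u)\<^sup>2"
      using power_mono[OF nv, of 2] by (simp add: power_mult_distrib)
    have "inner (v - f v) v = inner v (v - adj f v)"
      by (simp add: inner_diff_left inner_diff_right inner_apply_adj)
    also have "\<dots> \<le> norm v * norm (v - adj f v)"
      by (rule norm_cauchy_schwarz)
    also have "v - adj f v = - (adj ((b o\<^sub>L f) - b) u)"
      by (simp add: v_def adj_diff adj_compose blinfun.diff_left)
    also have "norm v * norm (- (adj ((b o\<^sub>L f) - b) u)) \<le> (norm b * norm u) * (c * norm u)"
      using f(3) nv c by (intro mult_mono) (auto intro!: norm_apply_le_norm)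
    finally have fv: "inner (v - f v) v \<le> norm b * c * (norm u)\<^sup>2"
      by (simp add: power2_eq_square ac_simps)
    have "(norm (adj ?g v - v))\<^sup>2 \<le> 2 * inner (v - adj ?g v) v"
      using g by (intro contraction_near_fixed_vector) simp
    also have "inner (v - adj ?g v) v = inner (v - f v) v - inner (T (e - a) v) v"
      using e a(1) inner_commute[of v "?g v"]
      by (simp add: T_diff a(2) blinfun.diff_left inner_diff_left adj_inner)
    also have "2 * \<dots> \<le> 2 * (norm b * c * (norm u)\<^sup>2 + 4 * c * ((norm b)\<^sup>2 * (norm u)\<^sup>2))"
    proof -
      have "4 * c * (norm v)\<^sup>2 \<le> 4 * c * ((norm b)\<^sup>2 * (norm u)\<^sup>2)"
        using c(1) by (intro mult_left_mono nv2) simp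
      moreover have "- (4 * c * (norm v)\<^sup>2) \<le> inner (T (e - a) v) v"
        using low[of v] by simp
      ultimately have "- inner (T (e - a) v) v \<le> 4 * c * ((norm b)\<^sup>2 * (norm u)\<^sup>2)"
        by (metis minus_le_iff order_trans)
      from add_mono[OF fv this] show ?thesis by simp
    qed
    also have "\<dots> = c * (d - 1) * (norm u)\<^sup>2"
      by (simp add: d_def algebra_simps)
    also have "\<dots> \<le> \<epsilon>\<^sup>2 * (norm u)\<^sup>2"
    proof (intro mult_right_mono)
      show "c * (d - 1) \<le> \<epsilon>\<^sup>2"
        using c by (simp add: right_diff_distrib)
    qed simp
    finally show "(norm (((adj ?g o\<^sub>L adj b) - adj b) u))\<^sup>2 \<le> \<epsilon>\<^sup>2 * (norm u)\<^sup>2"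
      by (simp add: v_def blinfun.diff_left)
  qed simp
  then have "norm ((adj ?g o\<^sub>L adj b) - adj b) \<le> \<epsilon>"
    by (rule power2_le_imp_le) (use \<open>0 < \<epsilon>\<close> in simp)
  moreover have "(adj ?g o\<^sub>L adj b) - adj b = adj ((b o\<^sub>L ?g) - b)"
    by (simp add: adj_diff adj_compose)
  ultimately have "norm ((b o\<^sub>L ?g) - b) \<le> \<epsilon>"
    by simp
  moreover have "norm ((e o\<^sub>L s) - s) \<le> \<epsilon>" if "s \<in> E" for s
    using y(3)[OF that] c(2) unfolding e_def by linarith
  ultimately show ?thesis using e e1 by blast
qed

text \<open>
  The difference between the product of \<open>B\<close> and the product of \<open>A\<close> transported by \<open>T\<close>.
\<close>

definition defect :: "'k op \<Rightarrow> 'k op \<Rightarrow> 'k op" where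
  "defect b d = (b o\<^sub>L d) - T (T_inv b o\<^sub>L T_inv d)"

lemma defect_mem: "b \<in> B \<Longrightarrow> d \<in> B \<Longrightarrow> defect b d \<in> B"
  unfolding defect_def by (intro B.diff_mem B.compose_mem T_mem A.compose_mem T_inv_mem)

lemma defect_bilinear: "complex_bilinear_product B defect"
proof
  fix a b d and c
  assume m: "a \<in> B" "b \<in> B"
  show "a + b \<in> B" "op_scaleC c a \<in> B" "defect a b \<in> B"
    using m by (auto intro: B.add_mem B.scaleC_mem defect_mem)
  have 1: "op_scaleC c f o\<^sub>L g = op_scaleC c (f o\<^sub>L g)" for f g :: "'x::chilbert_space op"
    by (rule blinfun_eqI) (simp add: op_scaleC.rep_eq)
  have 2: "f o\<^sub>L op_scaleC c g = op_scaleC c (f o\<^sub>L g)" if "f \<in> BH" for f g :: "'x::chilbert_space op"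
    by (rule blinfun_eqI) (use that in \<open>simp add: op_scaleC.rep_eq BH_def\<close>)
  have 3: "op_scaleC c (f - g) = op_scaleC c f - op_scaleC c g" for f g :: "'k op"
    by (metis (no_types) op_scaleC_add diff_add_cancel add_diff_cancel_right')
  show "defect (op_scaleC c a) b = op_scaleC c (defect a b)"
    using m by (simp add: defect_def 1 3 T_inv_scaleC T_scaleC A.compose_mem T_inv_mem)
  have "a \<in> BH" "T_inv a \<in> BH" using m T_inv_mem A.subset_BH B.subset_BH by auto
  then show "defect a (op_scaleC c b) = op_scaleC c (defect a b)"
    using m by (simp add: defect_def 2 3 T_inv_scaleC T_scaleC A.compose_mem T_inv_mem)
  assume d: "d \<in> B"
  note compose_add = bounded_bilinear.add_left[OF bounded_bilinear_blinfun_compose]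
    bounded_bilinear.add_right[OF bounded_bilinear_blinfun_compose]
  show "defect (a + b) d = defect a d + defect b d" "defect d (a + b) = defect d a + defect d b"
    using m d by (simp_all add: defect_def compose_add T_inv_add T_add A.compose_mem T_inv_mem)
qed

text \<open>
  Let \<open>x\<close>, \<open>y\<close> be the preimages of \<open>X\<close>, \<open>Y\<close>. A Moebius step in \<open>A\<close>, with the identity replaced by a unit
  \<open>e\<close>, gives a column \<open>(u, v)\<close> of norm at most \<open>1 + O(t\<^sup>2)\<close> up to a small error; its image is \<open>(X + t (T e - T(x\<^sup>2)), Y - t T(y x))\<close>. The
  inverse Moebius step in \<open>B\<close> leads, up to \<open>O(t\<^sup>2)\<close>, to \<open>(X + t \<delta>(X, X) + t (T e - 1), Y + t \<delta>(Y, X))\<close>. Since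
  \<open>T e\<close> is a unit as well, multiplication from the left by an almost unit \<open>f\<close> of \<open>B\<close> with \<open>f T e \<approx> f\<close>
  removes the term \<open>T e - 1\<close>.
\<close>

lemma column_stays_in_ball:
  assumes pos: "real_positive A B T" and X: "X \<in> B" and Y: "Y \<in> B"
    and ball: "norm (col X Y) \<le> 1" and t: "\<bar>t\<bar> \<le> 1/8"
  shows "norm (col (X + t *\<^sub>R defect X X) (Y + t *\<^sub>R defect Y X)) \<le> 1 + 371 * t\<^sup>2"
proof (rule field_le_epsilon)
  fix \<epsilon>' :: real assume "0 < \<epsilon>'"
  define \<epsilon> where "\<epsilon> = min (1/8) (\<epsilon>' / 61)"
  have \<epsilon>: "0 < \<epsilon>" "\<epsilon> \<le> 1/8" "61 * \<epsilon> \<le> \<epsilon>'"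
    using \<open>0 < \<epsilon>'\<close> by (auto simp: \<epsilon>_def)
  have t2: "t\<^sup>2 \<le> 1/64"
    using power_mono[OF t, of 2] by (simp add: power_divide)
  have t\<epsilon>: "\<bar>t\<bar> * r \<le> r" if "0 \<le> r" for r
    using mult_right_mono[of "\<bar>t\<bar>" 1 r] t that by simp
  define x y where "x = T_inv X" and "y = T_inv Y"
  have xy: "x \<in> A" "y \<in> A" "T x = X" "T y = Y"
    using X Y by (simp_all add: x_def y_def T_inv_mem T_T_inv)
  have cxy: "norm (col x y) \<le> 1"
    using ball norm_col_T[OF xy(1,2)] xy by simp
  have nx: "norm x \<le> 1" "norm y \<le> 1"
    using norm_le_norm_col[of x y] norm_le_norm_col[of y x] cxy norm_le_norm_col(2)[of y x] by auto
  have nX: "norm X \<le> 1" "norm Y \<le> 1"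
    using nx norm_T[OF xy(1)] norm_T[OF xy(2)] xy by auto
  obtain f where f: "f \<in> B" "norm f \<le> 1"
      "\<And>s. s \<in> {X, Y, defect X X, defect Y X} \<Longrightarrow> norm ((f o\<^sub>L s) - s) \<le> \<epsilon>"
    using B.contractive_unit[of "{X, Y, defect X X, defect Y X}" \<epsilon>] X Y \<epsilon>
    by (auto simp: defect_mem)
  obtain e where e: "e \<in> A" "norm e \<le> 1" "norm ((e o\<^sub>L x) - x) \<le> \<epsilon>" "norm ((e o\<^sub>L y) - y) \<le> \<epsilon>"
      "norm ((f o\<^sub>L T e) - f) \<le> \<epsilon>"
    using unit_with_unit_image[OF pos, of "{x, y}" f \<epsilon>] xy f \<epsilon> by auto
  define g where "g = T e"
  have g: "norm g \<le> 1" using e by (simp add: g_def norm_T)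
  define XX YX where "XX = T (x o\<^sub>L x)" and "YX = T (y o\<^sub>L x)"
  have nXX: "norm XX \<le> 1" "norm YX \<le> 1"
    unfolding XX_def YX_def using norm_blinfun_compose[of x x] norm_blinfun_compose[of y x]
      mult_mono[OF nx(1) nx(1)] mult_mono[OF nx(2) nx(1)] xy
    by (auto simp: norm_T A.compose_mem)

  (* The Moebius step in A, multiplied by e to make it an element of A. *)
  have "norm (col (x + t *\<^sub>R (id_blinfun - (x o\<^sub>L x))) (y - t *\<^sub>R (y o\<^sub>L x))) \<le> 1 + 24 * t\<^sup>2"
    using moebius_column[of x y 1 t] cxy t by simp
  then have 1: "norm (col (e o\<^sub>L (x + t *\<^sub>R (id_blinfun - (x o\<^sub>L x)))) (e o\<^sub>L (y - t *\<^sub>R (y o\<^sub>L x))))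
      \<le> 1 + 24 * t\<^sup>2"
    by (rule order_trans[OF norm_col_compose_left_le[OF e(2)]])
  define u v where "u = x + t *\<^sub>R (e - (x o\<^sub>L x))" and "v = y - t *\<^sub>R (y o\<^sub>L x)"
  have bound: "norm (t *\<^sub>R (((e o\<^sub>L z) - z) o\<^sub>L x) - ((e o\<^sub>L z) - z)) \<le> 2 * \<epsilon>"
    if "norm ((e o\<^sub>L z) - z) \<le> \<epsilon>" for z
  proof -
    have "norm (((e o\<^sub>L z) - z) o\<^sub>L x) \<le> \<epsilon> * 1"
      using that nx \<epsilon> by (intro order_trans[OF norm_blinfun_compose] mult_mono) auto
    then have "\<bar>t\<bar> * norm (((e o\<^sub>L z) - z) o\<^sub>L x) \<le> \<epsilon>"
      using t\<epsilon>[of "norm (((e o\<^sub>L z) - z) o\<^sub>L x)"] by simp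
    then show ?thesis
      using norm_triangle_ineq4[of "t *\<^sub>R (((e o\<^sub>L z) - z) o\<^sub>L x)" "(e o\<^sub>L z) - z"] that by simp
  qed
  have "u - (e o\<^sub>L (x + t *\<^sub>R (id_blinfun - (x o\<^sub>L x)))) = t *\<^sub>R (((e o\<^sub>L x) - x) o\<^sub>L x) - ((e o\<^sub>L x) - x)"
    unfolding u_def by (rule blinfun_eqI)
      (simp add: blinfun.add_left blinfun.diff_left blinfun.scaleR_left blinfun.add_right
        blinfun.diff_right blinfun.scaleR_right algebra_simps)
  then have du: "norm (u - (e o\<^sub>L (x + t *\<^sub>R (id_blinfun - (x o\<^sub>L x))))) \<le> 2 * \<epsilon>"
    using bound[OF e(3)] by (simp only:)
  have "v - (e o\<^sub>L (y - t *\<^sub>R (y o\<^sub>L x))) = t *\<^sub>R (((e o\<^sub>L y) - y) o\<^sub>L x) - ((e o\<^sub>L y) - y)"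
    unfolding v_def by (rule blinfun_eqI)
      (simp add: blinfun.add_left blinfun.diff_left blinfun.scaleR_left blinfun.add_right
        blinfun.diff_right blinfun.scaleR_right algebra_simps)
  then have dv: "norm (v - (e o\<^sub>L (y - t *\<^sub>R (y o\<^sub>L x)))) \<le> 2 * \<epsilon>"
    using bound[OF e(4)] by (simp only:)
  (* Transport to B; the bounds on t and epsilon keep the norm below 2. *)
  define \<rho> where "\<rho> = 1 + 24 * t\<^sup>2 + 4 * \<epsilon>"
  have uv: "u \<in> A" "v \<in> A"
    unfolding u_def v_def using xy e
    by (auto intro!: A.add_mem A.diff_mem A.scaleR_mem A.compose_mem)
  have "norm (col u v) \<le> \<rho>"
    using norm_col_perturb[OF 1 du dv] by (simp add: \<rho>_def)
  moreover define U V where "U = T u" and "V = T v"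
  ultimately have UV: "norm (col U V) \<le> \<rho>"
    using norm_col_T[OF uv] by simp
  have \<rho>: "1 \<le> \<rho>" "\<rho> \<le> 2"
    using \<epsilon> t2 zero_le_power2[of t] unfolding \<rho>_def by linarith+
  have U: "U = X + t *\<^sub>R (g - XX)"
    unfolding U_def u_def g_def XX_def using xy e
    by (simp add: T_add T_scaleR T_diff A.scaleR_mem A.diff_mem A.compose_mem)
  have V: "V = Y - t *\<^sub>R YX"
    unfolding V_def v_def YX_def using xy
    by (simp add: T_scaleR T_diff A.scaleR_mem A.compose_mem)
  (* The Moebius step in B in the opposite direction. *)
  have "norm (col (U + (-t) *\<^sub>R (id_blinfun - (U o\<^sub>L U))) (V - (-t) *\<^sub>R (V o\<^sub>L U)))
      \<le> 1 + 24 * (-t)\<^sup>2 + 14 * (\<rho> - 1)"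
    using moebius_column[OF UV \<rho>, of "-t"] t by simp
  also have "\<dots> = 1 + 360 * t\<^sup>2 + 56 * \<epsilon>"
    by (simp add: \<rho>_def)
  finally have 2: "norm (col (U + (-t) *\<^sub>R (id_blinfun - (U o\<^sub>L U))) (V - (-t) *\<^sub>R (V o\<^sub>L U)))
      \<le> 1 + 360 * t\<^sup>2 + 56 * \<epsilon>" .
  (* The second step starts from (U, V) instead of (X, Y); this costs another multiple of t^2. *)
  define P Q where "P = X + t *\<^sub>R (defect X X + g - id_blinfun)" and "Q = Y + t *\<^sub>R defect Y X"
  have nUV: "norm U \<le> 2" "norm V \<le> 2"
    using norm_le_norm_col[of U V] norm_le_norm_col(2)[of V U] UV \<rho> by linarith+
  have dU: "norm (U - X) \<le> 2 * \<bar>t\<bar>"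
  proof -
    have "norm (g - XX) \<le> 2" using norm_triangle_ineq4[of g XX] g nXX by linarith
    then show ?thesis using mult_left_mono[of "norm (g - XX)" 2 "\<bar>t\<bar>"] by (simp add: U)
  qed
  have dV: "norm (V - Y) \<le> \<bar>t\<bar>"
    using mult_left_mono[OF nXX(2), of "\<bar>t\<bar>"] by (simp add: V)
  have compose_le: "norm (h o\<^sub>L k) \<le> p * q" if "norm h \<le> p" "norm k \<le> q" for h k :: "'k op" and p q
    by (rule order_trans[OF norm_blinfun_compose
          mult_mono[OF that order_trans[OF norm_ge_zero that(1)] norm_ge_zero]])
  have dUU: "norm ((X o\<^sub>L X) - (U o\<^sub>L U)) \<le> 6 * \<bar>t\<bar>"
  proof -
    have eq: "(X o\<^sub>L X) - (U o\<^sub>L U) = - (U o\<^sub>L (U - X)) - ((U - X) o\<^sub>L X)"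
      by (rule blinfun_eqI) (simp add: blinfun.diff_left blinfun.diff_right blinfun.minus_left)
    show ?thesis
      unfolding eq using compose_le[OF nUV(1) dU] compose_le[OF dU nX(1)]
        norm_triangle_ineq4[of "- (U o\<^sub>L (U - X))" "(U - X) o\<^sub>L X"] by simp
  qed
  have dVU: "norm ((Y o\<^sub>L X) - (V o\<^sub>L U)) \<le> 5 * \<bar>t\<bar>"
  proof -
    have eq: "(Y o\<^sub>L X) - (V o\<^sub>L U) = - (V o\<^sub>L (U - X)) - ((V - Y) o\<^sub>L X)"
      by (rule blinfun_eqI) (simp add: blinfun.diff_left blinfun.diff_right blinfun.minus_left)
    show ?thesis
      unfolding eq using compose_le[OF nUV(2) dU] compose_le[OF dV nX(1)]
        norm_triangle_ineq4[of "- (V o\<^sub>L (U - X))" "(V - Y) o\<^sub>L X"] by simp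
  qed
  have tt: "\<bar>t\<bar> * (6 * \<bar>t\<bar>) = 6 * t\<^sup>2" "\<bar>t\<bar> * (5 * \<bar>t\<bar>) = 5 * t\<^sup>2"
    by (simp_all add: power2_eq_square)
  have "P - (U + (-t) *\<^sub>R (id_blinfun - (U o\<^sub>L U))) = t *\<^sub>R ((X o\<^sub>L X) - (U o\<^sub>L U))"
    unfolding P_def by (subst (1) U) (simp add: defect_def XX_def x_def algebra_simps)
  then have dP: "norm (P - (U + (-t) *\<^sub>R (id_blinfun - (U o\<^sub>L U)))) \<le> 6 * t\<^sup>2"
    using mult_left_mono[OF dUU, of "\<bar>t\<bar>"] tt by (simp only: norm_scaleR)
  have "Q - (V - (-t) *\<^sub>R (V o\<^sub>L U)) = t *\<^sub>R ((Y o\<^sub>L X) - (V o\<^sub>L U))"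
    unfolding Q_def by (subst (1) V) (simp add: defect_def YX_def x_def y_def algebra_simps)
  then have dQ: "norm (Q - (V - (-t) *\<^sub>R (V o\<^sub>L U))) \<le> 5 * t\<^sup>2"
    using mult_left_mono[OF dVU, of "\<bar>t\<bar>"] tt by (simp only: norm_scaleR)
  have "norm (col P Q) \<le> 1 + 371 * t\<^sup>2 + 56 * \<epsilon>"
    using norm_col_perturb[OF 2 dP dQ] by simp
  then have 3: "norm (col (f o\<^sub>L P) (f o\<^sub>L Q)) \<le> 1 + 371 * t\<^sup>2 + 56 * \<epsilon>"
    by (rule order_trans[OF norm_col_compose_left_le[OF f(2)]])

  (* After multiplication by f the column (P, Q) is close to the claimed one. *)
  have small: "norm (t *\<^sub>R z) \<le> \<epsilon>" if "norm z \<le> \<epsilon>" for z :: "'k op"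
    using t\<epsilon>[of "norm z"] that by simp
  have "X + t *\<^sub>R defect X X - (f o\<^sub>L P) =
      - ((f o\<^sub>L X) - X) - t *\<^sub>R ((f o\<^sub>L defect X X) - defect X X) - t *\<^sub>R ((f o\<^sub>L g) - f)"
    unfolding P_def by (rule blinfun_eqI)
      (simp add: blinfun.add_left blinfun.diff_left blinfun.scaleR_left blinfun.add_right
        blinfun.minus_left blinfun.diff_right blinfun.scaleR_right algebra_simps)
  moreover have "norm (- ((f o\<^sub>L X) - X) - t *\<^sub>R ((f o\<^sub>L defect X X) - defect X X) - t *\<^sub>R ((f o\<^sub>L g) - f))
      \<le> \<epsilon> + \<epsilon> + \<epsilon>"
    using f(3)[of X] small[OF f(3)[of "defect X X"]] small[OF e(5)[folded g_def]]
      norm_triangle_ineq4[of "- ((f o\<^sub>L X) - X) - t *\<^sub>R ((f o\<^sub>L defect X X) - defect X X)"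
        "t *\<^sub>R ((f o\<^sub>L g) - f)"]
      norm_triangle_ineq4[of "- ((f o\<^sub>L X) - X)" "t *\<^sub>R ((f o\<^sub>L defect X X) - defect X X)"]
    unfolding norm_minus_cancel by simp
  ultimately have dX: "norm (X + t *\<^sub>R defect X X - (f o\<^sub>L P)) \<le> \<epsilon> + \<epsilon> + \<epsilon>"
    by (simp only:)
  have "Y + t *\<^sub>R defect Y X - (f o\<^sub>L Q) =
      - ((f o\<^sub>L Y) - Y) - t *\<^sub>R ((f o\<^sub>L defect Y X) - defect Y X)"
    unfolding Q_def by (rule blinfun_eqI)
      (simp add: blinfun.add_left blinfun.diff_left blinfun.scaleR_left blinfun.add_right
        blinfun.minus_left blinfun.diff_right blinfun.scaleR_right algebra_simps)
  moreover have "norm (- ((f o\<^sub>L Y) - Y) - t *\<^sub>R ((f o\<^sub>L defect Y X) - defect Y X)) \<le> \<epsilon> + \<epsilon>"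
    using f(3)[of Y] small[OF f(3)[of "defect Y X"]]
      norm_triangle_ineq4[of "- ((f o\<^sub>L Y) - Y)" "t *\<^sub>R ((f o\<^sub>L defect Y X) - defect Y X)"]
    unfolding norm_minus_cancel by simp
  ultimately have dY: "norm (Y + t *\<^sub>R defect Y X - (f o\<^sub>L Q)) \<le> \<epsilon> + \<epsilon>"
    by (simp only:)
  show "norm (col (X + t *\<^sub>R defect X X) (Y + t *\<^sub>R defect Y X)) \<le> 1 + 371 * t\<^sup>2 + \<epsilon>'"
    using norm_col_perturb[OF 3 dX dY] \<epsilon>(3) by linarith
qed

text \<open>
  Both coordinates of the displacement are homogeneous of degree two, so rotating the column by the
  phase of \<open>s\<close> reduces to a real parameter.
\<close>

lemma column_stays_in_ball_complex:
  assumes pos: "real_positive A B T" and X: "X \<in> B" and Y: "Y \<in> B"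
    and ball: "norm (col X Y) \<le> 1" and s: "cmod s \<le> 1/8"
  shows "norm (col (X + op_scaleC s (defect X X)) (Y + op_scaleC s (defect Y X))) \<le> 1 + 371 * (cmod s)\<^sup>2"
proof -
  interpret D: complex_bilinear_product B defect by (rule defect_bilinear)
  define t where "t = cmod s"
  obtain c where c: "cmod c = 1" "s = of_real t * c"
  proof (cases "s = 0")
    case False
    then show ?thesis by (intro that[of "s / cmod s"]) (simp_all add: t_def norm_divide)
  qed (use that[of 1] in \<open>simp add: t_def\<close>)
  have "norm (col (op_scaleC c X) (op_scaleC c Y)) \<le> 1"
    using ball c by (simp add: norm_col_op_scaleC)
  then have "norm (col (op_scaleC c X + t *\<^sub>R defect (op_scaleC c X) (op_scaleC c X))
      (op_scaleC c Y + t *\<^sub>R defect (op_scaleC c Y) (op_scaleC c X))) \<le> 1 + 371 * t\<^sup>2"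
    using s by (intro column_stays_in_ball pos B.scaleC_mem X Y) (simp_all add: t_def)
  moreover have "op_scaleC c Z + t *\<^sub>R defect (op_scaleC c Z) (op_scaleC c X) =
      op_scaleC c (Z + op_scaleC s (defect Z X))" if "Z \<in> B" for Z
    using that X by (simp add: D.product_scaleC_left D.product_scaleC_right B.scaleC_mem
        op_scaleC_op_scaleC op_scaleC_add c(2) mult.left_commute flip: op_scaleC_of_real)
  ultimately show ?thesis
    using c(1) X Y by (simp add: norm_col_op_scaleC t_def)
qed

lemma homomorphism_of_real_positive:
  assumes "real_positive A B T"
  shows "algebra_homomorphism A B T"
  unfolding algebra_homomorphism_def
proof (intro conjI ballI)
  interpret D: complex_bilinear_product B defect by (rule defect_bilinear)
  fix a b assume ab: "a \<in> A" "b \<in> A"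
  have "defect (T a) (T b) = 0"
    by (rule D.product_eq_0[of 371])
      (use ab in \<open>auto intro: column_stays_in_ball_complex[OF assms] T_mem\<close>)
  then show "T (a o\<^sub>L b) = T a o\<^sub>L T b"
    using ab by (simp add: defect_def T_inv_T)
qed (rule linear)

end

section \<open>Multiplicative complete isometries are real completely positive\<close>

text \<open>
  The matrix \<open>e (1 - t x) e\<close>, where \<open>e\<close> acts diagonally.
\<close>

definition compressed_matrix :: "'h::chilbert_space op \<Rightarrow> real \<Rightarrow> 'h op_mat \<Rightarrow> 'h op_mat" where
  "compressed_matrix e t x =
     (\<lambda>i j. (if i = j then e o\<^sub>L e else 0) - t *\<^sub>R (e o\<^sub>L (x i j o\<^sub>L e)))"

lemma mat_apply_compressed_matrix:
  assumes "i < n"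
  shows "mat_apply n (compressed_matrix e t x) v i =
    blinfun_apply e (blinfun_apply e (v i) - t *\<^sub>R mat_apply n x (\<lambda>j. blinfun_apply e (v j)) i)"
proof -
  have "mat_apply n (compressed_matrix e t x) v i =
      (\<Sum>j<n. if i = j then e (e (v j)) else 0) - (\<Sum>j<n. t *\<^sub>R e (x i j (e (v j))))"
    unfolding mat_apply_def compressed_matrix_def sum_subtractf[symmetric]
    by (intro sum.cong) (auto simp: blinfun.diff_left blinfun.scaleR_left)
  also have "(\<Sum>j<n. if i = j then e (e (v j)) else 0) = e (e (v i))"
    using assms by simp
  finally show ?thesis
    by (simp add: mat_apply_def blinfun.diff_right blinfun.scaleR_right blinfun.sum_right
        scaleR_sum_right)
qed

text \<open>
  For accretive \<open>x\<close> the middle term in \<open>\<parallel>w - t x w\<parallel>\<^sup>2 = \<parallel>w\<parallel>\<^sup>2 - 2 t Re \<langle>x w, w\<rangle> + t\<^sup>2 \<parallel>x w\<parallel>\<^sup>2\<close> is not positive.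
\<close>

lemma mat_norm_compressed_matrix_le:
  assumes acc: "\<And>v. 0 \<le> (\<Sum>i<n. \<Sum>j<n. inner (blinfun_apply (x i j) (v j)) (v i))"
    and "0 \<le> t" "norm e \<le> 1"
  shows "mat_norm n (compressed_matrix e t x) \<le> 1 + t\<^sup>2 * (mat_norm n x)\<^sup>2"
proof (rule mat_norm_le)
  fix v :: "nat \<Rightarrow> 'a"
  define w where "w = (\<lambda>j. blinfun_apply e (v j))"
  let ?M = "mat_norm n x"
  have ew: "(norm (blinfun_apply e z))\<^sup>2 \<le> (norm z)\<^sup>2" for z
    using norm_apply_le_norm[OF assms(3), of z] by (intro power_mono) auto
  have "(vec_norm n (mat_apply n (compressed_matrix e t x) v))\<^sup>2 \<le>
      (\<Sum>i<n. (norm (w i - t *\<^sub>R mat_apply n x w i))\<^sup>2)"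
    unfolding vec_norm_sq w_def by (intro sum_mono) (simp add: mat_apply_compressed_matrix ew)
  also have "\<dots> = (\<Sum>i<n. (norm (w i))\<^sup>2 - 2 * t * (\<Sum>j<n. inner (x i j (w j)) (w i)) +
      t\<^sup>2 * (norm (mat_apply n x w i))\<^sup>2)"
  proof (intro sum.cong refl)
    fix i
    have "inner (mat_apply n x w i) (w i) = (\<Sum>j<n. inner (x i j (w j)) (w i))"
      by (simp add: mat_apply_def inner_sum_left)
    moreover have "(norm (w i - t *\<^sub>R mat_apply n x w i))\<^sup>2 = (norm (w i))\<^sup>2
        - 2 * t * inner (mat_apply n x w i) (w i) + t\<^sup>2 * (norm (mat_apply n x w i))\<^sup>2"
      unfolding power2_norm_eq_inner
      by (simp add: inner_diff_left inner_diff_right inner_commute power2_eq_square)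
    ultimately show "(norm (w i - t *\<^sub>R mat_apply n x w i))\<^sup>2 = (norm (w i))\<^sup>2
        - 2 * t * (\<Sum>j<n. inner (x i j (w j)) (w i)) + t\<^sup>2 * (norm (mat_apply n x w i))\<^sup>2"
      by simp
  qed
  also have "\<dots> = (vec_norm n w)\<^sup>2 - 2 * t * (\<Sum>i<n. \<Sum>j<n. inner (x i j (w j)) (w i)) +
      t\<^sup>2 * (vec_norm n (mat_apply n x w))\<^sup>2"
    by (simp add: vec_norm_sq sum.distrib sum_subtractf sum_distrib_left)
  also have "\<dots> \<le> (vec_norm n w)\<^sup>2 + t\<^sup>2 * (?M * vec_norm n w)\<^sup>2"
  proof -
    have "0 \<le> 2 * t * (\<Sum>i<n. \<Sum>j<n. inner (x i j (w j)) (w i))"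
      using acc[of w] assms(2) by simp
    moreover have "t\<^sup>2 * (vec_norm n (mat_apply n x w))\<^sup>2 \<le> t\<^sup>2 * (?M * vec_norm n w)\<^sup>2"
      by (intro mult_left_mono power_mono vec_norm_mat_apply_le) simp_all
    ultimately show ?thesis by linarith
  qed
  also have "\<dots> = (1 + t\<^sup>2 * ?M\<^sup>2) * (vec_norm n w)\<^sup>2"
    by (simp add: power_mult_distrib algebra_simps)
  also have "\<dots> \<le> (1 + t\<^sup>2 * ?M\<^sup>2)\<^sup>2 * (vec_norm n v)\<^sup>2"
  proof (intro mult_mono)
    have "(1 + t\<^sup>2 * ?M\<^sup>2) * 1 \<le> (1 + t\<^sup>2 * ?M\<^sup>2) * (1 + t\<^sup>2 * ?M\<^sup>2)"
      by (intro mult_left_mono) auto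
    then show "1 + t\<^sup>2 * ?M\<^sup>2 \<le> (1 + t\<^sup>2 * ?M\<^sup>2)\<^sup>2" by (simp add: power2_eq_square)
    show "(vec_norm n w)\<^sup>2 \<le> (vec_norm n v)\<^sup>2"
      unfolding vec_norm_sq w_def by (intro sum_mono ew)
  qed auto
  finally have "(vec_norm n (mat_apply n (compressed_matrix e t x) v))\<^sup>2 \<le>
      ((1 + t\<^sup>2 * ?M\<^sup>2) * vec_norm n v)\<^sup>2"
    by (simp add: power_mult_distrib)
  then show "vec_norm n (mat_apply n (compressed_matrix e t x) v) \<le> (1 + t\<^sup>2 * ?M\<^sup>2) * vec_norm n v"
    by (rule power2_le_imp_le) simp
qed simp

context complete_isometry
begin

lemma compressed_matrix_T:
  assumes mult: "\<And>a b. a \<in> A \<Longrightarrow> b \<in> A \<Longrightarrow> T (a o\<^sub>L b) = T a o\<^sub>L T b"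
    and "e \<in> A" "x i j \<in> A"
  shows "T (compressed_matrix e t x i j) = compressed_matrix (T e) t (amplification T x) i j"
  using assms(2,3) by (simp add: compressed_matrix_def amplification_def T_diff T_scaleR T_zero
      mult zero_mem A.compose_mem A.scaleR_mem)

text \<open>
  The images \<open>T e\<close> of a contractive approximate unit of \<open>A\<close> form one of \<open>B\<close>. The norm estimate for
  \<open>e (1 - t x) e\<close> passes to \<open>z = T\<^sub>n(x)\<close>. Evaluate its form at vectors \<open>w\<close> of the form \<open>(T e') v\<close>, on which
  \<open>T e\<close> tends to the identity, so that the limit bounds \<open>t Re \<langle>z w, w\<rangle>\<close> from below by a multiple of
  \<open>- t\<^sup>2\<close>. Then \<open>e'\<close> runs through the approximate unit, which gives the same bound at all \<open>v\<close>, and finally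
  \<open>t\<close> tends to \<open>0\<close> after division by \<open>t\<close>.
\<close>

lemma real_completely_positive_of_homomorphism:
  assumes "algebra_homomorphism A B T"
  shows "real_completely_positive A B T"
  unfolding real_completely_positive_def
proof (intro conjI linear allI impI subsetI)
  fix n :: nat and z
  assume n: "1 \<le> n" and "z \<in> amplification T ` mat_real_pos_elems n A"
  then obtain x where z: "z = amplification T x" and x: "x \<in> mat_over n A"
      and acc: "\<And>v. 0 \<le> (\<Sum>i<n. \<Sum>j<n. inner (blinfun_apply (x i j) (v j)) (v i))"
    by (auto simp: mat_real_pos_elems_iff[OF A.subset_BH])
  have mult: "T (a o\<^sub>L b) = T a o\<^sub>L T b" if "a \<in> A" "b \<in> A" for a b
    using assms that by (simp add: algebra_homomorphism_def)
  have xA: "x i j \<in> A" if "i < n" "j < n" for i j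
    using x that by (simp add: mat_over_def)
  have zB: "z i j \<in> B" if "i < n" "j < n" for i j
    using xA[OF that] by (simp add: z amplification_def T_mem)
  obtain F where F: "F \<noteq> bot" "\<forall>\<^sub>F e in F. e \<in> A \<and> norm e \<le> 1"
      "\<And>a. a \<in> A \<Longrightarrow> ((\<lambda>e. e o\<^sub>L a) \<longlongrightarrow> a) F" "\<And>a. a \<in> A \<Longrightarrow> ((\<lambda>e. a o\<^sub>L e) \<longlongrightarrow> a) F"
    using A.approximately_unital unfolding approximately_unital_def by blast
  have T_tendsto: "((\<lambda>e. T (h e)) \<longlongrightarrow> T a) F"
    if "(h \<longlongrightarrow> a) F" "a \<in> A" "\<forall>\<^sub>F e in F. h e \<in> A" for h a
  proof -
    have "((\<lambda>e. norm (h e - a)) \<longlongrightarrow> 0) F"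
      using that(1) by (intro tendsto_norm_zero) (simp add: LIM_zero)
    moreover have "\<forall>\<^sub>F e in F. norm (h e - a) = norm (T (h e) - T a)"
      using that(3) by eventually_elim
        (use that(2) in \<open>simp add: A.diff_mem norm_T flip: T_diff\<close>)
    ultimately have "((\<lambda>e. norm (T (h e) - T a)) \<longlongrightarrow> 0) F"
      using tendsto_cong by fast
    then show ?thesis by (simp add: LIM_zero_cancel tendsto_norm_zero_iff)
  qed
  have left: "((\<lambda>e. T e o\<^sub>L b) \<longlongrightarrow> b) F" and right: "((\<lambda>e. b o\<^sub>L T e) \<longlongrightarrow> b) F" if "b \<in> B" for b
  proof -
    have mem: "\<forall>\<^sub>F e in F. e \<in> A" using F(2) by eventually_elim simp
    have "((\<lambda>e. T (e o\<^sub>L T_inv b)) \<longlongrightarrow> b) F" "((\<lambda>e. T (T_inv b o\<^sub>L e)) \<longlongrightarrow> b) F"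
      using T_tendsto[OF F(3)[OF T_inv_mem[OF that]] T_inv_mem[OF that]]
        T_tendsto[OF F(4)[OF T_inv_mem[OF that]] T_inv_mem[OF that]] mem T_inv_mem[OF that]
      by (simp_all add: T_T_inv that A.compose_mem eventually_mono)
    moreover have "\<forall>\<^sub>F e in F. T (e o\<^sub>L T_inv b) = T e o\<^sub>L b" "\<forall>\<^sub>F e in F. T (T_inv b o\<^sub>L e) = b o\<^sub>L T e"
      using mem by (eventually_elim, use that in \<open>simp add: mult T_inv_mem T_T_inv\<close>)+
    ultimately show "((\<lambda>e. T e o\<^sub>L b) \<longlongrightarrow> b) F" "((\<lambda>e. b o\<^sub>L T e) \<longlongrightarrow> b) F"
      using tendsto_cong by fast+
  qed
  have contr: "\<forall>\<^sub>F e in F. norm (T e) \<le> 1"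
    using F(2) by eventually_elim (simp add: norm_T)
  (* Both T e and its adjoint are used as k below. *)
  have absorb: "((\<lambda>e. k e o\<^sub>L h e) \<longlongrightarrow> b) F"
    if k: "\<forall>\<^sub>F e in F. norm (k e) \<le> 1" "((\<lambda>e. k e o\<^sub>L b) \<longlongrightarrow> b) F" and h: "(h \<longlongrightarrow> b) F"
    for k h :: "'h op \<Rightarrow> 'k op" and b
  proof -
    have "((\<lambda>e. norm (h e - b)) \<longlongrightarrow> 0) F"
      using h by (intro tendsto_norm_zero) (simp add: LIM_zero)
    then have "((\<lambda>e. k e o\<^sub>L (h e - b)) \<longlongrightarrow> 0) F"
    proof (rule Lim_null_comparison[rotated])
      show "\<forall>\<^sub>F e in F. norm (k e o\<^sub>L (h e - b)) \<le> norm (h e - b)"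
        using k(1)
      proof eventually_elim
        case (elim e)
        show ?case
          using norm_blinfun_compose[of "k e" "h e - b"] mult_right_mono[OF elim, of "norm (h e - b)"]
          by simp
      qed
    qed
    from tendsto_add[OF this k(2)] show ?thesis
      by (simp add: bounded_bilinear.diff_right[OF bounded_bilinear_blinfun_compose])
  qed
  have adj_left: "((\<lambda>e. adj (T e) o\<^sub>L b) \<longlongrightarrow> b) F" if "b \<in> B" for b
  proof -
    have "((\<lambda>e. norm ((T e o\<^sub>L b) - b)) \<longlongrightarrow> 0) F"
      using left[OF that] by (intro tendsto_norm_zero) (simp add: LIM_zero)
    then have "((\<lambda>e. 2 * norm ((T e o\<^sub>L b) - b) * norm b) \<longlongrightarrow> 2 * 0 * norm b) F"
      by (intro tendsto_intros)
    then have lim: "((\<lambda>e. sqrt (2 * norm ((T e o\<^sub>L b) - b) * norm b)) \<longlongrightarrow> sqrt 0) F"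
      by (intro tendsto_real_sqrt) simp
    have "((\<lambda>e. (adj (T e) o\<^sub>L b) - b) \<longlongrightarrow> 0) F"
    proof (rule Lim_null_comparison)
      show "\<forall>\<^sub>F e in F. norm ((adj (T e) o\<^sub>L b) - b) \<le> sqrt (2 * norm ((T e o\<^sub>L b) - b) * norm b)"
        using contr by eventually_elim (intro real_le_rsqrt adj_left_unit)
    qed (use lim in simp)
    then show ?thesis by (rule LIM_zero_cancel)
  qed

  define M where "M = mat_norm n x"
  define q where "q v = (\<Sum>i<n. \<Sum>j<n. inner (blinfun_apply (z i j) (v j)) (v i))" for v
  have image_norm: "mat_norm n (compressed_matrix (T e) t z) \<le> 1 + t\<^sup>2 * M\<^sup>2"
    if "e \<in> A" "norm e \<le> 1" "0 \<le> t" for e t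
  proof -
    have diagonal: "(if i = j then e o\<^sub>L e else 0) \<in> A" for i j :: nat
      using that(1) by (simp add: A.compose_mem zero_mem)
    have "compressed_matrix e t x i j \<in> A" if "i < n" "j < n" for i j
      unfolding compressed_matrix_def
      by (intro A.diff_mem diagonal A.scaleR_mem A.compose_mem xA \<open>e \<in> A\<close> that)
    then have "compressed_matrix e t x \<in> mat_over n A"
      by (simp add: mat_over_def)
    then have "mat_norm n (amplification T (compressed_matrix e t x)) \<le> 1 + t\<^sup>2 * M\<^sup>2"
      using mat_norm_T[OF n] mat_norm_compressed_matrix_le[OF acc that(3,2)] by (simp add: M_def)
    moreover have "mat_apply n (amplification T (compressed_matrix e t x)) v i =
        mat_apply n (compressed_matrix (T e) t z) v i" if "i < n" for v i
      using xA \<open>i < n\<close> \<open>e \<in> A\<close> unfolding mat_apply_def amplification_def[of T "compressed_matrix e t x"]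
      by (intro sum.cong) (simp_all add: compressed_matrix_T[OF mult] z)
    then have "mat_norm n (amplification T (compressed_matrix e t x)) =
        mat_norm n (compressed_matrix (T e) t z)"
      unfolding mat_norm_def vec_norm_def by (intro SUP_cong refl L2_set_cong) simp_all
    ultimately show ?thesis by simp
  qed
  (* The limit along e, at vectors in the range of T e'. *)
  have lower: "- (t\<^sup>2 * M\<^sup>2) * (vec_norm n w)\<^sup>2 \<le> t * q w"
    if t: "0 \<le> t" and w: "w = (\<lambda>i. blinfun_apply (T e') (v i))" and e': "e' \<in> A" for t e' v w
  proof -
    define L where "L e = (\<Sum>i<n. inner (mat_apply n (compressed_matrix (T e) t z) w i) (w i))" for e
    have "L e \<le> (1 + t\<^sup>2 * M\<^sup>2) * (vec_norm n w)\<^sup>2" if "e \<in> A" "norm e \<le> 1" for e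
    proof -
      have "L e \<le> vec_norm n (mat_apply n (compressed_matrix (T e) t z) w) * vec_norm n w"
        unfolding L_def by (rule sum_inner_le_vec_norm)
      also have "\<dots> \<le> ((1 + t\<^sup>2 * M\<^sup>2) * vec_norm n w) * vec_norm n w"
        by (intro mult_right_mono order_trans[OF vec_norm_mat_apply_le] image_norm that t) simp_all
      finally show ?thesis by (simp add: power2_eq_square ac_simps)
    qed
    then have upper: "\<forall>\<^sub>F e in F. L e \<le> (1 + t\<^sup>2 * M\<^sup>2) * (vec_norm n w)\<^sup>2"
      using F(2) by (auto elim: eventually_mono)
    have "(L \<longlongrightarrow> (\<Sum>i<n. inner (w i - t *\<^sub>R mat_apply n z w i) (w i))) F"
      unfolding L_def
    proof (intro tendsto_sum tendsto_inner tendsto_const)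
      fix i assume "i \<in> {..<n}"
      then have i: "i < n" by simp
      have g: "T e' \<in> B" using e' by (rule T_mem)
      have "((\<lambda>e. T e o\<^sub>L (T e o\<^sub>L T e')) \<longlongrightarrow> T e') F"
        by (rule absorb[OF contr left[OF g] left[OF g]])
      then have 1: "((\<lambda>e. blinfun_apply (T e o\<^sub>L (T e o\<^sub>L T e')) (v i)) \<longlongrightarrow> w i) F"
        unfolding w by (intro tendsto_intros)
      have "((\<lambda>e. T e o\<^sub>L (z i j o\<^sub>L (T e o\<^sub>L T e'))) \<longlongrightarrow> z i j o\<^sub>L T e') F" if "j < n" for j
        by (rule absorb[OF contr left[OF B.compose_mem[OF zB[OF i that] g]]
              bounded_bilinear.tendsto[OF bounded_bilinear_blinfun_compose tendsto_const left[OF g]]])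
      then have 2: "((\<lambda>e. \<Sum>j<n. blinfun_apply (T e o\<^sub>L (z i j o\<^sub>L (T e o\<^sub>L T e'))) (v j)) \<longlongrightarrow>
          (\<Sum>j<n. blinfun_apply (z i j o\<^sub>L T e') (v j))) F"
        by (intro tendsto_sum blinfun.tendsto tendsto_const) auto
      have "((\<lambda>e. blinfun_apply (T e o\<^sub>L (T e o\<^sub>L T e')) (v i) -
          t *\<^sub>R (\<Sum>j<n. blinfun_apply (T e o\<^sub>L (z i j o\<^sub>L (T e o\<^sub>L T e'))) (v j))) \<longlongrightarrow>
          w i - t *\<^sub>R (\<Sum>j<n. blinfun_apply (z i j o\<^sub>L T e') (v j))) F"
        by (intro tendsto_intros 1 2)
      then show "((\<lambda>e. mat_apply n (compressed_matrix (T e) t z) w i) \<longlongrightarrow>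
          w i - t *\<^sub>R mat_apply n z w i) F"
        unfolding mat_apply_compressed_matrix[OF i] by (simp add: w mat_apply_def blinfun.diff_right
            blinfun.scaleR_right blinfun.sum_right)
    qed
    then have "(\<Sum>i<n. inner (w i - t *\<^sub>R mat_apply n z w i) (w i)) \<le> (1 + t\<^sup>2 * M\<^sup>2) * (vec_norm n w)\<^sup>2"
      using upper F(1) by (rule tendsto_upperbound)
    moreover have "(\<Sum>i<n. inner (w i - t *\<^sub>R mat_apply n z w i) (w i)) = (vec_norm n w)\<^sup>2 - t * q w"
      by (simp add: q_def vec_norm_sq mat_apply_def inner_diff_left inner_sum_left sum_subtractf
          sum_distrib_left power2_norm_eq_inner)
    ultimately show ?thesis by (simp add: algebra_simps)
  qed
  have "0 \<le> q v" for v
  proof -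
    (* The limit along e', using that (T e')* z (T e') tends to z. *)
    have scaled: "- (t\<^sup>2 * M\<^sup>2) * (vec_norm n v)\<^sup>2 \<le> t * q v" if t: "0 \<le> t" for t
    proof (rule tendsto_lowerbound)
      have "((\<lambda>e. adj (T e) o\<^sub>L (z i j o\<^sub>L T e)) \<longlongrightarrow> z i j) F" if "i < n" "j < n" for i j
        by (rule absorb[OF _ adj_left[OF zB[OF that]] right[OF zB[OF that]]]) (use contr in simp)
      then have "((\<lambda>e. \<Sum>i<n. \<Sum>j<n. inner (blinfun_apply (adj (T e) o\<^sub>L (z i j o\<^sub>L T e)) (v j)) (v i))
          \<longlongrightarrow> q v) F"
        unfolding q_def by (intro tendsto_sum tendsto_inner blinfun.tendsto tendsto_const) auto
      then have "((\<lambda>e. q (\<lambda>i. blinfun_apply (T e) (v i))) \<longlongrightarrow> q v) F"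
        by (simp add: q_def adj_inner)
      then show "((\<lambda>e. t * q (\<lambda>i. blinfun_apply (T e) (v i))) \<longlongrightarrow> t * q v) F"
        by (intro tendsto_intros)
      show "\<forall>\<^sub>F e in F. - (t\<^sup>2 * M\<^sup>2) * (vec_norm n v)\<^sup>2 \<le> t * q (\<lambda>i. blinfun_apply (T e) (v i))"
        using F(2)
      proof eventually_elim
        case (elim e)
        have "(vec_norm n (\<lambda>i. blinfun_apply (T e) (v i)))\<^sup>2 \<le> (vec_norm n v)\<^sup>2"
          unfolding vec_norm_sq
          using norm_apply_le_norm[of "T e" 1] elim
          by (intro sum_mono power_mono) (simp_all add: norm_T)
        then have "t\<^sup>2 * M\<^sup>2 * (vec_norm n (\<lambda>i. blinfun_apply (T e) (v i)))\<^sup>2 \<le>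
            t\<^sup>2 * M\<^sup>2 * (vec_norm n v)\<^sup>2"
          by (intro mult_left_mono) simp_all
        then show ?case
          using lower[OF t refl, of e v] elim by simp
      qed
    qed (rule F(1))
    have "((\<lambda>t. - (t * M\<^sup>2) * (vec_norm n v)\<^sup>2) \<longlongrightarrow> - (0 * M\<^sup>2) * (vec_norm n v)\<^sup>2) (at_right 0)"
      by (intro tendsto_intros)
    moreover have "\<forall>\<^sub>F t in at_right 0. - (t * M\<^sup>2) * (vec_norm n v)\<^sup>2 \<le> q v"
    proof (rule eventually_at_rightI[of 0 1])
      fix t :: real assume "t \<in> {0<..<1}"
      then have "t * (- (t * M\<^sup>2) * (vec_norm n v)\<^sup>2) \<le> t * q v" "0 < t"
        using scaled[of t] by (simp_all add: power2_eq_square ac_simps)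
      then show "- (t * M\<^sup>2) * (vec_norm n v)\<^sup>2 \<le> q v"
        by (simp only: mult_le_cancel_left_pos)
    qed simp
    ultimately have "- (0 * M\<^sup>2) * (vec_norm n v)\<^sup>2 \<le> q v"
      by (rule tendsto_upperbound) simp
    then show ?thesis by simp
  qed
  then show "z \<in> mat_real_pos_elems n B"
    using zB by (auto simp: mat_real_pos_elems_iff[OF B.subset_BH] mat_over_def q_def)
qed

lemma real_positive_of_real_completely_positive:
  assumes "real_completely_positive A B T"
  shows "real_positive A B T"
  unfolding real_positive_def
proof (intro conjI linear subsetI)
  fix b assume "b \<in> T ` real_pos_elems A"
  then obtain a where a: "b = T a" "a \<in> real_pos_elems A" by blast
  then have "(\<lambda>i j. a) \<in> mat_real_pos_elems 1 A"
    by (simp add: mat_real_pos_elems_iff[OF A.subset_BH] real_pos_elems_iff[OF A.subset_BH]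
        mat_over_def)
  then have "amplification T (\<lambda>i j. a) \<in> mat_real_pos_elems 1 B"
    using assms unfolding real_completely_positive_def by blast
  then have "(\<lambda>i j. b) \<in> mat_real_pos_elems 1 B"
    by (simp add: amplification_def a)
  then show "b \<in> real_pos_elems B"
    by (auto simp: mat_real_pos_elems_iff[OF B.subset_BH] real_pos_elems_iff[OF B.subset_BH]
        mat_over_def)
qed

end

theorem proposition6p5:
  fixes A :: "'h::chilbert_space op set"
    and B :: "'k::chilbert_space op set"
    and T :: "'h op \<Rightarrow> 'k op"
  assumes "operator_algebra A" and "approximately_unital A"
    and "operator_algebra B" and "approximately_unital B"
    and "completely_isometric_surjection A B T"
  shows "(real_positive A B T \<longleftrightarrow> algebra_homomorphism A B T) \<and>
         (real_completely_positive A B T \<longleftrightarrow> algebra_homomorphism A B T)"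
proof -
  interpret complete_isometry A B T
    using assms by unfold_locales
  show ?thesis
    using homomorphism_of_real_positive real_completely_positive_of_homomorphism
      real_positive_of_real_completely_positive by blast
qed

end
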